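(* Let $n\ge2$ and let $X$ be a locally connected metric continuum. Let $C(X)=C(X,\mathbb{R}^n)$ be the set of all generalized paths (continuous maps) $X\to\mathbb{R}^n$, with the metric $d_{\mathrm{sup}}(\gamma_1,\gamma_2)=\sup_{p\in X}|\gamma_1(p)-\gamma_2(p)|$. Then the function $\mathsf{len}: C(X) \to \mathbb{R}$ is continuous.
   Context: A continuum is a nonempty compact connected metric space. A generalized path is a continuous map $\gamma: X\to\mathbb{R}^n$ where $X$ is a locally connected metric continuum. Definition of $\mathsf{len}=\mathsf{len}_n$. For a unit vector $u\in \mathbb{S}^{n-1}$, $x\in[0,1]$, $\mu\in(0,1]$ and $j\in\mathbb{Z}$ put $S_j^{x,u,\mu}=\{z\in\mathbb{R}^n: \mu(j+x)\le\langle z,u\rangle\le\mu(j+1+x)\}$, and for $A\subset\mathbb{R}^n$ put $\|A\|_u=\mathrm{diam}\{\langle z,u\rangle: z\in A\}$. Given a generalized path $\gamma:X\to\mathbb{R}^n$, let $C_0,C_1,C_2,\ldots$ (a finite or infinite list) enumerate all connected components $C$ of the sets $\gamma^{-1}(S_j^{x,u,\mu})$, $j\in\mathbb{Z}$, for which $\|\gamma(C)\|_u>0$, ordered so that $\|\gamma(C_k)\|_u\ge\|\gamma(C_{k+1})\|_u$ for all $k$ (this is possible, since for each $\varepsilon>0$ only finitely many such components have $\|\gamma(C)\|_u\ge\varepsilon$). Put $L^{x,u,\mu}(\gamma)=\sum_{k\ge0}2^{-k}\|\gamma(C_k)\|_u$ (missing terms count as $0$), and $$\mathsf{len}(\gamma)=\int_0^1\int_{\mathbb{S}^{n-1}}\int_0^1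 L^{x,u,\mu}(\gamma)\,dx\,d\sigma(u)\,d\mu,$$ where $\sigma$ is the rotation-invariant probability measure on $\mathbb{S}^{n-1}$. (Replacing $u$ by $-u$ does not change the integral over $x$, so equivalently one integrates over $(n-1)$-dimensional real projective space; for $n=2$, identifying $\mathbb{R}^2$ with $\mathbb{C}$, one may take $u=ie^{t\pi i}$ and integrate $dt$ over $t\in[0,1]$.) *)

theory Defs
  imports "HOL-Analysis.Analysis"
begin

definition slab :: "real \<Rightarrow> real ^ 'n \<Rightarrow> real \<Rightarrow> int \<Rightarrow> (real ^ 'n) set" where
  "slab x u \<mu> j = {z. \<mu> * (real_of_int j + x) \<le> z \<bullet> u \<and> z \<bullet> u \<le> \<mu> * (real_of_int j + 1 + x)}"

definition width :: "real ^ 'n \<Rightarrow> (real ^ 'n) set \<Rightarrow> real" where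
  "width u A = diameter ((\<lambda>z. z \<bullet> u) ` A)"

text \<open>
  A single set can be a component of the preimages of two different slabs only if its image lies
  in their common bounding hyperplane and so has width 0. Collecting the components for all \<open>j\<close>
  in one set therefore identifies nothing that should be counted twice.
\<close>

definition slab_components ::
    "'a::metric_space set \<Rightarrow> ('a \<Rightarrow> real ^ 'n) \<Rightarrow> real \<Rightarrow> real ^ 'n \<Rightarrow> real \<Rightarrow> 'a set set" where
  "slab_components X \<gamma> x u \<mu> =
     {C. (\<exists>j. C \<in> components (X \<inter> \<gamma> -` slab x u \<mu> j)) \<and> width u (\<gamma> ` C) > 0}"

definition enum_index :: "'b set \<Rightarrow> nat set" where
  "enum_index F = (if finite F then {..<card F} else UNIV)"

definition decreasing_enumeration :: "('b \<Rightarrow> real) \<Rightarrow> 'b set \<Rightarrow> (nat \<Rightarrow> 'b) \<Rightarrow> bool" where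
  "decreasing_enumeration w F C \<longleftrightarrow>
     bij_betw C (enum_index F) F \<and>
     (\<forall>k. Suc k \<in> enum_index F \<longrightarrow> w (C (Suc k)) \<le> w (C k))"

text \<open>
  Two decreasing enumerations differ only by permuting components of equal width, so the value
  does not depend on the chosen one.
\<close>

definition slab_length ::
    "'a::metric_space set \<Rightarrow> ('a \<Rightarrow> real ^ 'n) \<Rightarrow> real \<Rightarrow> real ^ 'n \<Rightarrow> real \<Rightarrow> real" where
  "slab_length X \<gamma> x u \<mu> =
     (let F = slab_components X \<gamma> x u \<mu>;
          C = (SOME C. decreasing_enumeration (\<lambda>C. width u (\<gamma> ` C)) F C)
      in \<Sum>k. if k \<in> enum_index F then width u (\<gamma> ` C k) / 2 ^ k else 0)"

text \<open>
  The rotation-invariant probability measure on the unit sphere, as the image of the normalised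
  Lebesgue measure on the unit ball under the radial projection \<open>x \<mapsto> x / |x|\<close>, which is
  \<open>sgn\<close> (the origin, where \<open>sgn\<close> is 0, is a null set). It is the only
  rotation-invariant Borel probability measure on the sphere; existence, i.e. that the
  measure below has these properties, is verified after the definition.
\<close>

definition sphere_measure :: "(real ^ 'n) measure" where
  "sphere_measure =
     restrict_space (distr (uniform_measure lborel (ball 0 1)) borel sgn) (sphere 0 1)"

lemma space_sphere_measure: "space (sphere_measure :: (real ^ 'n) measure) = sphere 0 1"
  by (simp add: sphere_measure_def space_restrict_space)

lemma sets_sphere_measure:
  "sets (sphere_measure :: (real ^ 'n) measure) = sets (restrict_space borel (sphere 0 1))"
  by (simp add: sphere_measure_def sets_restrict_space)

lemma borel_measurable_sgn_vec: "(sgn :: real ^ 'n \<Rightarrow> real ^ 'n) \<in> borel_measurable borel"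
  unfolding sgn_div_norm by measurable

lemma emeasure_sphere_measure:
  fixes A :: "(real ^ 'n) set"
  assumes "A \<in> sets borel" "A \<subseteq> sphere 0 1"
  shows "emeasure sphere_measure A =
    emeasure lborel (ball 0 1 \<inter> sgn -` A) / emeasure lborel (ball (0 :: real ^ 'n) 1)"
proof -
  have m: "sgn -` A \<in> sets (borel :: (real ^ 'n) measure)"
    using measurable_sets[OF borel_measurable_sgn_vec assms(1)] by simp
  have "emeasure sphere_measure A =
      emeasure (distr (uniform_measure lborel (ball 0 1)) borel sgn) A"
    unfolding sphere_measure_def using assms(2) by (intro emeasure_restrict_space) auto
  also have "\<dots> = emeasure (uniform_measure lborel (ball 0 1)) (sgn -` A)"
    using assms(1) borel_measurable_sgn_vec
    by (subst emeasure_distr) (auto simp: measurable_cong_sets[of "uniform_measure lborel (ball 0 1)" borel])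
  also have "\<dots> = emeasure lborel (ball 0 1 \<inter> sgn -` A) / emeasure lborel (ball (0 :: real ^ 'n) 1)"
    using m by (intro emeasure_uniform_measure) auto
  finally show ?thesis .
qed

lemma emeasure_unit_ball:
  "emeasure lborel (ball (0 :: real ^ 'n) 1) \<noteq> 0" "emeasure lborel (ball (0 :: real ^ 'n) 1) \<noteq> \<infinity>"
  using content_ball_pos[of 1 "0 :: real ^ 'n"]
    emeasure_bounded_finite[of "ball (0 :: real ^ 'n) 1"]
  by (auto simp: measure_def)

lemma emeasure_sphere_measure_space:
  "emeasure sphere_measure (space (sphere_measure :: (real ^ 'n) measure)) = 1"
proof -
  have "ball 0 1 \<inter> sgn -` sphere 0 1 = ball (0 :: real ^ 'n) 1 - {0}"
    by (auto simp: norm_sgn)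
  moreover have "emeasure lborel (ball (0 :: real ^ 'n) 1 - {0}) = emeasure lborel (ball (0 :: real ^ 'n) 1)"
    by (intro emeasure_Diff_null_set) auto
  ultimately show ?thesis
    using emeasure_unit_ball[where 'n = 'n]
    by (simp add: space_sphere_measure emeasure_sphere_measure ennreal_divide_self less_top)
qed

lemma nn_integral_lborel_translate:
  fixes h :: "'b::euclidean_space \<Rightarrow> ennreal"
  assumes [measurable]: "h \<in> borel_measurable borel"
  shows "(\<integral>\<^sup>+ y. h (c + y) \<partial>lborel) = (\<integral>\<^sup>+ y. h y \<partial>lborel)"
  by (subst (2) lborel_distr_plus[of c, symmetric], subst nn_integral_distr) auto

lemma nn_integral_lborel_reflect:
  fixes h :: "'b::euclidean_space \<Rightarrow> ennreal"
  assumes [measurable]: "h \<in> borel_measurable borel"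
  shows "(\<integral>\<^sup>+ y. h (c - y) \<partial>lborel) = (\<integral>\<^sup>+ y. h y \<partial>lborel)"
proof -
  have "lborel = distr lborel borel (\<lambda>y::'b. c - y)"
    using lborel_affine[of "- 1" c] by (simp add: density_1)
  then have "(\<integral>\<^sup>+ y. h y \<partial>lborel) = (\<integral>\<^sup>+ y. h y \<partial>distr lborel borel (\<lambda>y::'b. c - y))"
    by simp
  also have "\<dots> = (\<integral>\<^sup>+ y. h (c - y) \<partial>lborel)"
    by (subst nn_integral_distr) auto
  finally show ?thesis by simp
qed

lemma emeasure_lborel_vimage_orthogonal:
  fixes f :: "'b::euclidean_space \<Rightarrow> 'b"
  assumes f: "orthogonal_transformation f" and A[measurable]: "A \<in> sets borel"
  shows "emeasure lborel (f -` A) = emeasure lborel A"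
proof -
  have lin: "linear f" and nf: "\<And>x. norm (f x) = norm x"
    using f by (auto simp: orthogonal_transformation)
  have fm[measurable]: "f \<in> borel_measurable borel"
    by (intro borel_measurable_continuous_onI linear_continuous_on linear_conv_bounded_linear[THEN iffD1] lin)
  define g where "g = inv f"
  have fg: "f (g y) = y" for y
    unfolding g_def by (rule surj_f_inv_f[OF orthogonal_transformation_surj[OF f]])
  define B where "B = ball (0::'b) 1"
  have B[measurable]: "B \<in> sets borel" by (simp add: B_def)
  have fB: "f -` B = B" by (auto simp: B_def nf)
  have vm[measurable]: "f -` A \<in> sets borel"
    using measurable_sets[OF fm A] by simp
  have "emeasure lborel (f -` A) * emeasure lborel B =
      (\<integral>\<^sup>+ x. indicator A (f x) * (\<integral>\<^sup>+ y. indicator B y \<partial>lborel) \<partial>lborel)"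
    by (simp add: nn_integral_multc flip: indicator_vimage)
  also have "\<dots> = (\<integral>\<^sup>+ x. (\<integral>\<^sup>+ y. indicator A (f x) * indicator B (f x + y) \<partial>lborel) \<partial>lborel)"
    by (simp add: nn_integral_cmult nn_integral_lborel_translate[where h = "indicator B"]
        del: nn_integral_indicator)
  also have "\<dots> = (\<integral>\<^sup>+ y. (\<integral>\<^sup>+ x. indicator A (f x) * indicator B (f x + y) \<partial>lborel) \<partial>lborel)"
    by (rule lborel_pair.Fubini'[symmetric]) measurable
  also have "\<dots> = (\<integral>\<^sup>+ y. (\<integral>\<^sup>+ x. indicator A (f x - y) * indicator B (f x) \<partial>lborel) \<partial>lborel)"
  proof (rule nn_integral_cong)
    fix y
    have "(\<integral>\<^sup>+ x. indicator A (f x) * indicator B (f x + y) \<partial>lborel) =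
        (\<integral>\<^sup>+ x. indicator A (f (- g y + x)) * indicator B (f (- g y + x) + y) \<partial>lborel)"
      by (rule nn_integral_lborel_translate[symmetric]) measurable
    then show "(\<integral>\<^sup>+ x. indicator A (f x) * indicator B (f x + y) \<partial>lborel) =
        (\<integral>\<^sup>+ x. indicator A (f x - y) * indicator B (f x) \<partial>lborel)"
      by (simp add: linear_diff[OF lin] fg)
  qed
  also have "\<dots> = (\<integral>\<^sup>+ x. (\<integral>\<^sup>+ y. indicator A (f x - y) * indicator B (f x) \<partial>lborel) \<partial>lborel)"
    by (rule lborel_pair.Fubini') measurable
  also have "\<dots> = (\<integral>\<^sup>+ x. emeasure lborel A * indicator B (f x) \<partial>lborel)"
    by (simp add: nn_integral_multc nn_integral_lborel_reflect[where h = "indicator A"])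
  also have "\<dots> = emeasure lborel A * emeasure lborel B"
    using fB by (simp add: nn_integral_cmult flip: indicator_vimage)
  finally have "emeasure lborel (f -` A) * emeasure lborel B = emeasure lborel A * emeasure lborel B" .
  moreover have "emeasure lborel B \<noteq> 0" "emeasure lborel B \<noteq> \<infinity>"
    using emeasure_bounded_finite[of B] content_ball_pos[of 1 "0::'b"]
    by (auto simp: B_def measure_def)
  ultimately show ?thesis
    by (simp add: ennreal_mult_cancel_left mult.commute[of _ "emeasure lborel B"])
qed

lemma sphere_measure_rotation_invariant:
  fixes f :: "real ^ 'n \<Rightarrow> real ^ 'n"
  assumes f: "orthogonal_transformation f"
  shows "distr sphere_measure sphere_measure f = sphere_measure"
proof (rule measure_eqI)
  show "sets (distr sphere_measure sphere_measure f) = sets sphere_measure" by simp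
  fix A assume "A \<in> sets (distr sphere_measure sphere_measure f)"
  then have A: "A \<in> sets borel" "A \<subseteq> sphere 0 1"
    by (auto simp: sets_sphere_measure sets_restrict_space)
  have lin: "linear f" and nf: "\<And>x. norm (f x) = norm x"
    using f by (auto simp: orthogonal_transformation)
  have fm: "f \<in> borel_measurable borel"
    using lin by (intro borel_measurable_continuous_onI linear_continuous_on linear_conv_bounded_linear[THEN iffD1])
  have ms: "f \<in> measurable sphere_measure sphere_measure"
    unfolding measurable_cong_sets[OF sets_sphere_measure sets_sphere_measure]
    using fm nf by (intro measurable_restrict_space3) auto
  have sgnf: "sgn (f x) = f (sgn x)" for x
    using lin nf by (simp add: sgn_div_norm linear_cmul)
  define B where "B = ball 0 1 \<inter> sgn -` A"
  have Bm: "B \<in> sets borel"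
    using measurable_sets[OF borel_measurable_sgn_vec A(1)] by (auto simp: B_def)
  have fA: "f -` A \<in> sets borel" "f -` A \<subseteq> sphere 0 1"
    using measurable_sets[OF fm A(1)] A(2) nf by auto
  have im: "ball 0 1 \<inter> sgn -` (f -` A) = f -` B"
    by (auto simp: B_def sgnf nf)
  note eq = emeasure_lborel_vimage_orthogonal[OF f Bm]
  have "emeasure (distr sphere_measure sphere_measure f) A =
      emeasure sphere_measure (f -` A \<inter> space sphere_measure)"
    using A by (intro emeasure_distr ms) (auto simp: sets_sphere_measure sets_restrict_space)
  also have "f -` A \<inter> space sphere_measure = f -` A"
    using fA(2) by (auto simp: space_sphere_measure)
  also have "emeasure sphere_measure (f -` A) = emeasure sphere_measure A"
    using eq by (simp add: emeasure_sphere_measure[OF fA] emeasure_sphere_measure[OF A] im flip: B_def)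
  finally show "emeasure (distr sphere_measure sphere_measure f) A = emeasure sphere_measure A" .
qed

definition len :: "'a::metric_space set \<Rightarrow> ('a \<Rightarrow> real ^ 'n) \<Rightarrow> real" where
  "len X \<gamma> =
     (LINT \<mu>:{0<..1}|lborel. (LINT u|sphere_measure. (LINT x:{0..1}|lborel. slab_length X \<gamma> x u \<mu>)))"

text \<open>
  The space of continuous maps on \<open>X\<close> is the library's \<open>cfunspace\<close>, whose
  points are normalised to be \<open>undefined\<close> outside \<open>X\<close>. For compact \<open>X\<close>
  its boundedness condition is automatic and its distance is the supremum distance:
\<close>

lemma mspace_cfunspace_compact:
  fixes X :: "'a::metric_space set"
  assumes "compact X"
  shows "mspace (cfunspace (top_of_set X) (euclidean_metric :: (real ^ 'n) metric)) =
    {\<gamma> \<in> extensional X. continuous_on X \<gamma>}"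
  using assms
  by (subst compactin_mspace_cfunspace) (auto simp: compactin_subtopology)

lemma mdist_cfunspace_compact:
  fixes X :: "'a::metric_space set" and \<gamma>\<^sub>1 \<gamma>\<^sub>2 :: "'a \<Rightarrow> real ^ 'n"
  assumes "compact X" "X \<noteq> {}"
    and "\<gamma>\<^sub>1 \<in> mspace (cfunspace (top_of_set X) euclidean_metric)"
    and "\<gamma>\<^sub>2 \<in> mspace (cfunspace (top_of_set X) euclidean_metric)"
  shows "mdist (cfunspace (top_of_set X) euclidean_metric) \<gamma>\<^sub>1 \<gamma>\<^sub>2 = (SUP p\<in>X. norm (\<gamma>\<^sub>1 p - \<gamma>\<^sub>2 p))"
  using assms subsetD[OF cfunspace_subset_funspace assms(3)] subsetD[OF cfunspace_subset_funspace assms(4)]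
  by (simp add: mdist_cfunspace_eq_mdist_funspace Met_TC.fdist_def dist_norm
      del: mspace_cfunspace)

end

theory Submission
  imports Defs
begin

text \<open>
  Fix \<open>u\<close> and put \<open>f p = \<gamma> p \<bullet> u\<close>. By local connectedness and compactness, every component whose
  width exceeds a fixed bound meets a fixed finite set \<open>G\<close> at points whose values lie strictly inside
  the slab, so the wide components are determined by which points of \<open>G\<close> are joined inside which slab.
  For a uniform limit of functions, points that are not joined stay unjoined, because a decreasing
  intersection of continua is connected; joined points stay joined provided that they are already
  joined inside a slightly thinner slab. Hence all terms of \<open>L\<close> converge if the latter holds for all
  pairs from a countable dense set \<open>D\<close>. For a pair from \<open>D\<close> and a fixed midline of the slab, at
  most one thickness \<open>\<mu>\<close> violates this, so by Fubini's theorem almost every \<open>(x, \<mu>)\<close> is good, and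
  dominated convergence gives the result after the integrals over \<open>u\<close> and \<open>\<mu>\<close> have been
  exchanged. The exchange requires \<open>L\<close> to be jointly Borel in \<open>(x, u, \<mu>)\<close>: the relation that two
  given points are joined in a given slab is closed in \<open>(x, u, \<mu>)\<close>, and counting the components
  through points of \<open>D\<close> involves only countably many such relations.

  For fixed \<open>\<mu>\<close> the bad \<open>x\<close> can have positive measure, so integrating over \<open>x\<close> alone is not enough.
\<close>

subsection \<open>Level sets of functions on compact spaces\<close>

text \<open>By normality a separation of the intersection extends to disjoint open sets
  \<open>U\<close> and \<open>V\<close>. Every \<open>C N\<close> meets both and is connected, so it
  has a point outside \<open>U \<union> V\<close>; by compactness so does the intersection.\<close>

lemma connected_decreasing_Inter:
  fixes C :: "nat \<Rightarrow> 'a::metric_space set"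
  assumes comp: "\<And>n. compact (C n)" and conn: "\<And>n. connected (C n)" and dec: "decseq C"
  shows "connected (\<Inter>n. C n)"
  unfolding connected_closed
proof (intro notI, elim exE conjE)
  fix A B assume AB: "closed A" "closed B" "(\<Inter>n. C n) \<subseteq> A \<union> B" "A \<inter> B \<inter> (\<Inter>n. C n) = {}"
    and ne: "A \<inter> (\<Inter>n. C n) \<noteq> {}" "B \<inter> (\<Inter>n. C n) \<noteq> {}"
  have cl: "closed (\<Inter>n. C n)"
    using comp by (intro closed_INT) (auto intro: compact_imp_closed)
  obtain U V where UV: "open U" "open V" "A \<inter> (\<Inter>n. C n) \<subseteq> U" "B \<inter> (\<Inter>n. C n) \<subseteq> V" "U \<inter> V = {}"
    using t4_space[of "A \<inter> (\<Inter>n. C n)" "B \<inter> (\<Inter>n. C n)"] AB(1,2,4) cl by blast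
  have "C 0 \<inter> (\<Inter>n. C n - (U \<union> V)) \<noteq> {}"
  proof (rule compact_imp_fip_image[OF comp])
    show "closed (C n - (U \<union> V))" for n
      using comp[of n] UV by (intro closed_Diff) (auto intro: compact_imp_closed)
    fix I :: "nat set" assume "finite I"
    then obtain N where N: "\<And>i. i \<in> I \<Longrightarrow> i \<le> N"
      by (meson finite_nat_set_iff_bounded_le)
    have "U \<inter> C N \<noteq> {}" "V \<inter> C N \<noteq> {}" using ne UV(3,4) by blast+
    then have "\<not> C N \<subseteq> U \<union> V"
      using conn[of N, unfolded connected_def] UV(1,2,5) by blast
    then obtain z where "z \<in> C N" "z \<notin> U \<union> V" by blast
    then have "z \<in> C 0 \<inter> (\<Inter>i\<in>I. C i - (U \<union> V))"
      using decseqD[OF dec, of _ N] N by fast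
    then show "C 0 \<inter> (\<Inter>i\<in>I. C i - (U \<union> V)) \<noteq> {}" by blast
  qed
  then show False using AB(3) UV(3,4) by blast
qed

definition level :: "'a set \<Rightarrow> ('a \<Rightarrow> real) \<Rightarrow> real \<Rightarrow> real \<Rightarrow> 'a set" where
  "level X f s t = {z \<in> X. s \<le> f z \<and> f z \<le> t}"

lemma compact_level:
  fixes X :: "'a::metric_space set"
  assumes "compact X" "continuous_on X f"
  shows "compact (level X f s t)"
proof -
  have "compact (X \<inter> f -` {s..t})"
    using assms compact_imp_closed continuous_on_closed_vimage
    by (metis Int_commute closed_atLeastAtMost compact_Int_closed inf.absorb2 inf.orderI inf_left_idem)
  moreover have "X \<inter> f -` {s..t} = level X f s t" by (auto simp: level_def)
  ultimately show ?thesis by simp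
qed

lemma level_mono:
  assumes "\<And>z. z \<in> X \<Longrightarrow> \<bar>g z - f z\<bar> \<le> e" "s' \<le> s - e" "t + e \<le> t'"
  shows "level X f s t \<subseteq> level X g s' t'"
  using assms by (fastforce simp: level_def abs_le_iff)

text \<open>The components of \<open>p\<close> in thickened level sets form a decreasing sequence of
  continua containing \<open>q\<close>, whose intersection is connected and lies in the original
  level set. Contrapositively, unjoined points stay unjoined after a slight thickening.\<close>

lemma connected_component_level_limit:
  fixes X :: "'a::metric_space set"
  assumes X: "compact X" "continuous_on X f"
    and c: "\<And>e. e > 0 \<Longrightarrow> connected_component (level X f (s - e) (t + e)) p q"
  shows "connected_component (level X f s t) p q"
proof -
  define L where "L n = level X f (s - 1 / Suc n) (t + 1 / Suc n)" for n
  define C where "C n = connected_component_set (L n) p" for n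
  have q: "q \<in> C n" for n using c[of "1 / Suc n"] by (simp add: C_def L_def)
  have p: "p \<in> C n" for n
    using q[of n] by (auto simp: C_def connected_component_in)
  have Lmono: "L n \<subseteq> L m" if "m \<le> n" for m n
    unfolding L_def using that by (intro level_mono[where e=0]) (auto simp: field_simps)
  have "connected (\<Inter>n. C n)"
  proof (rule connected_decreasing_Inter)
    show "compact (C n)" for n
      unfolding C_def L_def using compact_level[OF X]
      by (metis closed_connected_component closed_Int_compact compact_imp_closed connected_component_subset inf.absorb1)
    show "connected (C n)" for n by (simp add: C_def)
    show "decseq C"
      unfolding C_def decseq_def using Lmono by (auto intro: connected_component_of_subset)
  qed
  moreover have "(\<Inter>n. C n) \<subseteq> level X f s t"
  proof
    fix z assume "z \<in> (\<Inter>n. C n)"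
    then have z: "z \<in> L n" for n
      using connected_component_subset[of "L n" p] by (auto simp: C_def)
    have "s \<le> f z"
    proof (rule field_le_epsilon)
      fix e :: real assume "e > 0"
      then obtain n where "1 / Suc n < e" using nat_approx_posE by blast
      then show "s \<le> f z + e" using z[of n] by (auto simp: L_def level_def)
    qed
    moreover have "f z \<le> t"
    proof (rule field_le_epsilon)
      fix e :: real assume "e > 0"
      then obtain n where "1 / Suc n < e" using nat_approx_posE by blast
      then show "f z \<le> t + e" using z[of n] by (auto simp: L_def level_def)
    qed
    ultimately show "z \<in> level X f s t" using z[of 0] by (auto simp: L_def level_def)
  qed
  ultimately show ?thesis
    using p q unfolding connected_component_def by blast
qed

text \<open>Smallness refers to the oscillation of \<open>f\<close> on the connecting set, not to
  its diameter, since only values decide about staying inside a slab. \<open>G\<close> may be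
  infinite, so that a dense set can serve for all radii at once.\<close>

definition fine_net :: "'a::metric_space set \<Rightarrow> ('a \<Rightarrow> real) \<Rightarrow> 'a set \<Rightarrow> real \<Rightarrow> bool" where
  "fine_net X f G r \<longleftrightarrow> G \<subseteq> X \<and>
    (\<forall>p\<in>X. \<exists>g\<in>G. \<exists>V. connected V \<and> V \<subseteq> X \<and> p \<in> V \<and> g \<in> V \<and> (\<forall>z\<in>V. \<bar>f z - f p\<bar> < r))"

lemma fine_netE:
  assumes "fine_net X f G r" "p \<in> X"
  obtains g V where "g \<in> G" "connected V" "V \<subseteq> X" "p \<in> V" "g \<in> V" "\<And>z. z \<in> V \<Longrightarrow> \<bar>f z - f p\<bar> < r"
proof -
  have "\<exists>g\<in>G. \<exists>V. connected V \<and> V \<subseteq> X \<and> p \<in> V \<and> g \<in> V \<and> (\<forall>z\<in>V. \<bar>f z - f p\<bar> < r)"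
    using assms by (simp add: fine_net_def)
  then obtain g V where "g \<in> G" and "connected V \<and> V \<subseteq> X \<and> p \<in> V \<and> g \<in> V \<and> (\<forall>z\<in>V. \<bar>f z - f p\<bar> < r)"
    by (elim bexE exE)
  then show ?thesis by (intro that[of g V]) simp_all
qed

text \<open>Local connectedness gives each point a connected neighbourhood on which \<open>f\<close>
  stays within \<open>r / 2\<close> of its value there. Finitely many of them cover
  \<open>X\<close>, and each contributes a point of \<open>D\<close>. Comparing two points of one
  neighbourhood through its centre costs \<open>r\<close>.\<close>

lemma finite_fine_net_exists:
  fixes X :: "'a::metric_space set"
  assumes X: "compact X" "locally connected X" and f: "continuous_on X f" and r: "r > 0"
    and D: "D \<subseteq> X" "X \<subseteq> closure D"
  obtains G where "finite G" "G \<subseteq> D" "fine_net X f G r"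
proof -
  have "\<exists>W V d. open W \<and> connected V \<and> p \<in> W \<and> X \<inter> W \<subseteq> V \<and> V \<subseteq> X \<and>
      (\<forall>z\<in>V. \<bar>f z - f p\<bar> < r / 2) \<and> d \<in> D \<inter> W" if p: "p \<in> X" for p
  proof -
    have "openin (top_of_set X) (X \<inter> f -` ball (f p) (r / 2))"
      using f continuous_openin_preimage_gen by blast
    moreover have "p \<in> X \<inter> f -` ball (f p) (r / 2)" using p r by simp
    ultimately obtain U V where UV: "openin (top_of_set X) U" "connected V" "p \<in> U" "U \<subseteq> V"
      "V \<subseteq> X \<inter> f -` ball (f p) (r / 2)"
      by (rule locallyE[OF X(2)])
    then obtain W where W: "open W" "U = X \<inter> W" by (auto simp: openin_open)
    moreover have "D \<inter> W \<noteq> {}"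
      using W UV(3) p D(2) open_Int_closure_eq_empty[of W D] by blast
    ultimately obtain d where d: "d \<in> D \<inter> W" by blast
    have "\<bar>f z - f p\<bar> < r / 2" if "z \<in> V" for z
      using UV(5) that by (auto simp: dist_real_def abs_minus_commute)
    then show ?thesis
      using UV d W by (intro exI[of _ W] exI[of _ V] exI[of _ d]) auto
  qed
  then obtain W V d where *: "\<forall>p\<in>X. open (W p) \<and> connected (V p) \<and> p \<in> W p \<and> X \<inter> W p \<subseteq> V p \<and> V p \<subseteq> X \<and>
      (\<forall>z\<in>V p. \<bar>f z - f p\<bar> < r / 2) \<and> d p \<in> D \<inter> W p"
    by metis
  then have W: "\<And>p. p \<in> X \<Longrightarrow> open (W p)" "\<And>p. p \<in> X \<Longrightarrow> p \<in> W p"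
    and V: "\<And>p. p \<in> X \<Longrightarrow> connected (V p)" "\<And>p. p \<in> X \<Longrightarrow> X \<inter> W p \<subseteq> V p"
      "\<And>p. p \<in> X \<Longrightarrow> V p \<subseteq> X" "\<And>p z. p \<in> X \<Longrightarrow> z \<in> V p \<Longrightarrow> \<bar>f z - f p\<bar> < r / 2"
    and d: "\<And>p. p \<in> X \<Longrightarrow> d p \<in> D \<inter> W p"
    by blast+
  obtain P where P: "P \<subseteq> X" "finite P" "X \<subseteq> (\<Union>p\<in>P. W p)"
    using compactE_image[OF X(1), of X W] W by blast
  have "fine_net X f (d ` P) r"
    unfolding fine_net_def
  proof (intro conjI ballI)
    show "d ` P \<subseteq> X" using d P(1) D(1) by blast
    fix q assume q: "q \<in> X"
    then obtain p where p: "p \<in> P" "q \<in> W p" using P by blast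
    then have pX: "p \<in> X" using P by blast
    have qV: "q \<in> V p" using V(2)[OF pX] p q by blast
    have "\<bar>f z - f q\<bar> < r" if "z \<in> V p" for z
      using V(4)[OF pX that] V(4)[OF pX qV] by linarith
    moreover have "d p \<in> V p" using d[OF pX] V(2)[OF pX] D(1) by blast
    ultimately show "\<exists>g\<in>d ` P. \<exists>V. connected V \<and> V \<subseteq> X \<and> q \<in> V \<and> g \<in> V \<and> (\<forall>z\<in>V. \<bar>f z - f q\<bar> < r)"
      using p(1) V(1,3)[OF pX] qV by (intro bexI[of _ "d p"] exI[of _ "V p"]) auto
  qed
  moreover have "d ` P \<subseteq> D" using d P(1) by (metis IntD1 image_subsetI subsetD)
  ultimately show ?thesis using that[of "d ` P"] P(2) by simp
qed

lemma fine_net_mono: "fine_net X f G r \<Longrightarrow> G \<subseteq> D \<Longrightarrow> D \<subseteq> X \<Longrightarrow> fine_net X f D r"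
  unfolding fine_net_def by blast

text \<open>The values at \<open>z\<close> and at \<open>p\<close> each move by at most
  \<open>e\<close>, hence \<open>2 * e\<close>. One finite net thus serves a function and all its
  small perturbations.\<close>

lemma fine_net_perturb:
  assumes "fine_net X f G r" and "\<And>z. z \<in> X \<Longrightarrow> \<bar>g z - f z\<bar> \<le> e"
  shows "fine_net X g G (r + 2 * e)"
  unfolding fine_net_def
proof (intro conjI ballI)
  show "G \<subseteq> X" using assms by (simp add: fine_net_def)
  fix p assume p: "p \<in> X"
  obtain h V where V: "h \<in> G" "connected V" "V \<subseteq> X" "p \<in> V" "h \<in> V" "\<And>z. z \<in> V \<Longrightarrow> \<bar>f z - f p\<bar> < r"
    by (rule fine_netE[OF assms(1) p], rule that)
  have "\<bar>g z - g p\<bar> < r + 2 * e" if "z \<in> V" for z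
    using assms(2)[of z] assms(2)[OF p] V(3) V(6)[OF that] that by (auto simp: abs_le_iff abs_less_iff)
  then show "\<exists>h\<in>G. \<exists>V. connected V \<and> V \<subseteq> X \<and> p \<in> V \<and> h \<in> V \<and> (\<forall>z\<in>V. \<bar>g z - g p\<bar> < r + 2 * e)"
    using V(1-5) by (intro bexI[of _ h] exI[of _ V]) auto
qed

lemma component_contains_near:
  assumes "C \<in> components L" "p \<in> C" "connected V" "V \<subseteq> L" "p \<in> V"
  shows "V \<subseteq> C"
  using assms by (meson components_maximal disjoint_iff)

text \<open>The points \<open>p\<close> and \<open>q\<close> have values \<open>r\<close> inside the
  ends of the interval from \<open>f a\<close> to \<open>f b\<close>. The small connected sets
  around them therefore do not leave the slab, so they lie in \<open>C\<close> together with their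
  net points. Each end loses less than \<open>2 * r\<close>.\<close>

lemma wide_component_net_points:
  fixes X :: "'a::metric_space set"
  assumes f: "compact X" "continuous_on X f" and C: "C \<in> components (level X f s t)"
    and w: "diameter (f ` C) > \<tau>" and r: "r > 0" "4 * r \<le> \<tau>" and G: "fine_net X f G r"
  obtains d e where "d \<in> G" "d \<in> C" "e \<in> G" "e \<in> C" "s < f d" "f d < t" "\<tau> - 4 * r < f e - f d"
proof -
  have CL: "C \<subseteq> level X f s t" and CX: "C \<subseteq> X"
    using in_components_subset[OF C] by (auto simp: level_def)
  have "bounded (f ` C)"
    using CL by (intro bounded_subset[OF bounded_closed_interval[of s t]]) (auto simp: level_def)
  from diameter_lower_bounded[OF this _ w] r
  obtain a b where "a \<in> C" "b \<in> C" "\<tau> < dist (f a) (f b)" by auto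
  then obtain a b where ab: "a \<in> C" "b \<in> C" "\<tau> < f b - f a"
    by (cases "f a \<le> f b") (auto simp: dist_real_def)
  have st: "s \<le> f a" "f b \<le> t" using ab CL by (auto simp: level_def)
  have "connected (f ` C)"
    using C CX f(2) by (meson connected_continuous_image continuous_on_subset in_components_connected)
  from connected_contains_Icc[OF this, of "f a" "f b"] ab have I: "{f a..f b} \<subseteq> f ` C" by auto
  have "f a + r \<in> {f a..f b}" "f b - r \<in> {f a..f b}" using ab r by auto
  with I have "f a + r \<in> f ` C" "f b - r \<in> f ` C" by blast+
  then obtain p q where pq: "p \<in> C" "f p = f a + r" "q \<in> C" "f q = f b - r"
    by (elim imageE) auto
  have near: "\<exists>g\<in>G. g \<in> C \<and> \<bar>f g - f z\<bar> < r" if z: "z \<in> C" "f a + r \<le> f z" "f z \<le> f b - r" for z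
  proof -
    obtain g V where V: "g \<in> G" "connected V" "V \<subseteq> X" "z \<in> V" "g \<in> V" "\<And>y. y \<in> V \<Longrightarrow> \<bar>f y - f z\<bar> < r"
      using fine_netE[OF G, of z] z(1) CX by (metis subsetD)
    have "V \<subseteq> level X f s t"
    proof
      fix y assume "y \<in> V"
      then show "y \<in> level X f s t" using V(3) V(6)[of y] z st by (auto simp: level_def)
    qed
    then have "V \<subseteq> C" using component_contains_near[OF C z(1)] V by blast
    then show ?thesis using V by blast
  qed
  obtain d e where "d \<in> G" "d \<in> C" "\<bar>f d - f p\<bar> < r" "e \<in> G" "e \<in> C" "\<bar>f e - f q\<bar> < r"
    using near[OF pq(1)] near[OF pq(3)] pq(2,4) ab r by auto
  then show ?thesis using pq ab st r that[of d e] by auto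
qed

subsection \<open>Counting the wide components\<close>

text \<open>With \<open>f p = \<gamma> p \<bullet> u\<close> this is the preimage of a slab; for a
  fixed direction only this scalar function matters.\<close>

definition in_slab :: "'a::metric_space set \<Rightarrow> ('a \<Rightarrow> real) \<Rightarrow> real \<Rightarrow> real \<Rightarrow> int \<Rightarrow> 'a set" where
  "in_slab X f x \<mu> j = level X f (\<mu> * (of_int j + x)) (\<mu> * (of_int j + 1 + x))"

definition strip_components :: "'a::metric_space set \<Rightarrow> ('a \<Rightarrow> real) \<Rightarrow> real \<Rightarrow> real \<Rightarrow> 'a set set" where
  "strip_components X f x \<mu> = {C. (\<exists>j. C \<in> components (in_slab X f x \<mu> j)) \<and> diameter (f ` C) > 0}"

lemma slab_components_eq: "slab_components X \<gamma> x u \<mu> = strip_components X (\<lambda>p. \<gamma> p \<bullet> u) x \<mu>"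
proof -
  have "X \<inter> \<gamma> -` slab x u \<mu> j = in_slab X (\<lambda>p. \<gamma> p \<bullet> u) x \<mu> j" for j
    by (auto simp: slab_def in_slab_def level_def)
  then show ?thesis
    by (simp add: slab_components_def strip_components_def width_def image_image)
qed

text \<open>Counting wide components replaces the chosen enumeration: for \<open>\<mu> > 0\<close>
  and \<open>\<tau> \<ge> 0\<close>, the width of index \<open>k\<close> exceeds
  \<open>\<tau>\<close> exactly when this holds with \<open>n = Suc k\<close>.\<close>

definition many_wide :: "'a::metric_space set \<Rightarrow> ('a \<Rightarrow> real) \<Rightarrow> real \<Rightarrow> real \<Rightarrow> nat \<Rightarrow> real \<Rightarrow> bool" where
  "many_wide X f x \<mu> n \<tau> \<longleftrightarrow> (\<exists>A \<subseteq> strip_components X f x \<mu>. finite A \<and> card A = n \<and> (\<forall>C\<in>A. \<tau> < diameter (f ` C)))"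

text \<open>A triple \<open>(d, e, j)\<close> stands for the component of \<open>d\<close> in slab
  \<open>j\<close>, with \<open>e\<close> certifying its width; the second clause keeps the
  components of distinct triples in one slab apart. Only point values and the relation of being
  joined occur, and both can be followed through limits.\<close>

definition wide_witness ::
    "'a::metric_space set \<Rightarrow> ('a \<Rightarrow> real) \<Rightarrow> real \<Rightarrow> real \<Rightarrow> ('a \<times> 'a \<times> int) set \<Rightarrow> real \<Rightarrow> bool" where
  "wide_witness X f x \<mu> T \<tau> \<longleftrightarrow>
    (\<forall>(d, e, j)\<in>T. connected_component (in_slab X f x \<mu> j) d e \<and> \<tau> < f e - f d) \<and>
    (\<forall>(d, e, j)\<in>T. \<forall>(d', e', j')\<in>T. j = j' \<and> connected_component (in_slab X f x \<mu> j) d d' \<longrightarrow> (d, e, j) = (d', e', j'))"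

section \<open>Wide components and the point pairs that witness them\<close>

lemma slab_step:
  fixes \<mu> x :: real
  assumes "\<mu> > 0" "j < j'"
  shows "\<mu> * (of_int j + 1 + x) \<le> \<mu> * (of_int j' + x)"
proof -
  have "real_of_int j + 1 \<le> of_int j'" using assms(2) by linarith
  then show ?thesis using assms(1) by simp
qed

text \<open>Sending a triple to the component of its first point is injective, so there are as many
  components as triples; each has width at least \<open>f e - f d\<close>.\<close>

lemma many_wide_of_witness:
  fixes X :: "'a::metric_space set"
  assumes mu: "\<mu> > 0" and tau: "\<tau> \<ge> 0" and T: "finite T" "wide_witness X f x \<mu> T \<tau>"
  shows "many_wide X f x \<mu> (card T) \<tau>"
proof -
  define c where "c = (\<lambda>(d :: 'a, e :: 'a, j). connected_component_set (in_slab X f x \<mu> j) d)"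
  have T1: "connected_component (in_slab X f x \<mu> j) d e" "\<tau> < f e - f d" if "(d, e, j) \<in> T" for d e j
    using that T(2) unfolding wide_witness_def by blast+
  have T2: "(d, e, j) = (d', e', j')" if "(d, e, j) \<in> T" "(d', e', j') \<in> T" "j = j'"
      "connected_component (in_slab X f x \<mu> j) d d'" for d e j d' e' j'
    using that T(2) unfolding wide_witness_def by fast
  \<comment> \<open>A component common to slabs \<open>j < j'\<close> would give
    \<open>f e \<le> f d\<close>, because the top of the lower slab is not above the bottom of the
    higher one; but \<open>f e - f d > \<tau> \<ge> 0\<close>.\<close>
  have lt: "\<not> j < j'" if "(d, e, j) \<in> T" "(d', e', j') \<in> T" "c (d, e, j) = c (d', e', j')"
    for d e j d' e' j'
  proof
    assume "j < j'"
    note st = slab_step[OF mu this, of x]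
    have "e \<in> c (d, e, j)" "d \<in> c (d', e', j')"
      using T1[OF that(1)] that(3) by (auto simp: c_def connected_component_in)
    then have "e \<in> in_slab X f x \<mu> j" "d \<in> in_slab X f x \<mu> j'"
      by (auto simp: c_def dest: connected_component_in)
    then have "f e \<le> f d" using st by (auto simp: in_slab_def level_def)
    then show False using T1[OF that(1)] tau by simp
  qed
  have "inj_on c T"
  proof (rule inj_onI)
    fix y y' assume y: "y \<in> T" "y' \<in> T" "c y = c y'"
    obtain d e j d' e' j' where yy: "y = (d, e, j)" "y' = (d', e', j')" by (cases y, cases y')
    note t = y(1,2)[unfolded yy] and eq = y(3)[unfolded yy]
    have j: "j = j'" using lt[OF t eq] lt[OF t(2,1) eq[symmetric]] by simp
    have "d' \<in> c (d, e, j)"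
      using T1[OF t(2)] unfolding eq by (auto simp: c_def connected_component_in)
    then have "connected_component (in_slab X f x \<mu> j) d d'" by (simp add: c_def)
    then show "y = y'" using T2[OF t j] by (simp add: yy)
  qed
  moreover have "c y \<in> strip_components X f x \<mu> \<and> \<tau> < diameter (f ` c y)" if y: "y \<in> T" for y
  proof -
    obtain d e j where dej: "y = (d, e, j)" by (cases y)
    have de: "d \<in> c y" "e \<in> c y"
      using T1[of d e j] y by (auto simp: c_def dej connected_component_in)
    have comp: "c y \<in> components (in_slab X f x \<mu> j)"
      using T1[of d e j] y by (auto simp: c_def dej intro!: componentsI dest: connected_component_in)
    have "bounded (f ` c y)"
      using in_components_subset[OF comp]
      by (intro bounded_subset[OF bounded_closed_interval[of "\<mu> * (of_int j + x)" "\<mu> * (of_int j + 1 + x)"]])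
        (auto simp: level_def in_slab_def)
    from diameter_bounded_bound[OF this, of "f e" "f d"] de T1[of d e j] y
    have "\<tau> < diameter (f ` c y)" by (simp add: dej dist_real_def)
    then show ?thesis using comp tau by (auto simp: strip_components_def)
  qed
  ultimately show ?thesis
    unfolding many_wide_def using T(1) by (intro exI[of _ "c ` T"]) (auto simp: card_image)
qed

text \<open>Two points are chosen in each wide component. \<open>G\<close> and
  \<open>\<sigma>\<close> are left open, since this is applied both to a net of fixed radius with
  some loss of width and to a dense set with none.\<close>

lemma witness_of_many_wide:
  assumes "many_wide X f x \<mu> n \<tau>"
    and pick: "\<And>C j. C \<in> components (in_slab X f x \<mu> j) \<Longrightarrow> \<tau> < diameter (f ` C) \<Longrightarrow>
      \<exists>d\<in>G. \<exists>e\<in>G. d \<in> C \<and> e \<in> C \<and> \<sigma> < f e - f d"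
  shows "\<exists>T \<subseteq> G \<times> G \<times> UNIV. finite T \<and> card T = n \<and> wide_witness X f x \<mu> T \<sigma>"
proof -
  obtain A where A: "A \<subseteq> strip_components X f x \<mu>" "finite A" "card A = n" "\<forall>C\<in>A. \<tau> < diameter (f ` C)"
    using assms(1) unfolding many_wide_def by blast
  have "\<forall>C\<in>A. \<exists>j d e. C \<in> components (in_slab X f x \<mu> j) \<and> d \<in> G \<and> e \<in> G \<and> d \<in> C \<and> e \<in> C \<and> \<sigma> < f e - f d"
    using A pick unfolding strip_components_def by blast
  then obtain j d e where "\<forall>C\<in>A. C \<in> components (in_slab X f x \<mu> (j C)) \<and>
      d C \<in> G \<and> e C \<in> G \<and> d C \<in> C \<and> e C \<in> C \<and> \<sigma> < f (e C) - f (d C)"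
    by metis
  then have *: "\<And>C. C \<in> A \<Longrightarrow> C \<in> components (in_slab X f x \<mu> (j C))"
    "\<And>C. C \<in> A \<Longrightarrow> d C \<in> G" "\<And>C. C \<in> A \<Longrightarrow> e C \<in> G" "\<And>C. C \<in> A \<Longrightarrow> d C \<in> C" "\<And>C. C \<in> A \<Longrightarrow> e C \<in> C"
    "\<And>C. C \<in> A \<Longrightarrow> \<sigma> < f (e C) - f (d C)"
    by blast+
  define h where "h C = (d C, e C, j C)" for C
  have same: "C = C'" if "C \<in> A" "C' \<in> A" "j C = j C'" "connected_component (in_slab X f x \<mu> (j C)) (d C) (d C')" for C C'
    using that * by (metis components_eq components_iff connected_component_eq disjoint_iff mem_Collect_eq)
  have cc: "connected_component (in_slab X f x \<mu> (j C)) (d C) z" if "C \<in> A" "z \<in> C" for C z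
    using *(1,4)[OF that(1)] that(2) unfolding connected_component_def
    by (meson in_components_connected in_components_subset)
  have inj: "inj_on h A"
    unfolding h_def inj_on_def using same cc *(4) by (metis Pair_inject)
  have "wide_witness X f x \<mu> (h ` A) \<sigma>"
    unfolding wide_witness_def h_def
  proof (intro conjI ballI)
    fix t assume "t \<in> (\<lambda>C. (d C, e C, j C)) ` A"
    then obtain C where C: "C \<in> A" "t = (d C, e C, j C)" by blast
    show "case t of (d, e, j) \<Rightarrow> connected_component (in_slab X f x \<mu> j) d e \<and> \<sigma> < f e - f d"
      using C *(5,6) cc by simp
    show "case t of (d', e', j') \<Rightarrow> \<forall>(d'', e'', j'')\<in>(\<lambda>C. (d C, e C, j C)) ` A.
        j' = j'' \<and> connected_component (in_slab X f x \<mu> j') d' d'' \<longrightarrow> (d', e', j') = (d'', e'', j'')"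
      using C(1) same[OF C(1)] by (auto simp: C(2)) metis+
  qed
  then show ?thesis
    using card_image[OF inj] A(2,3) *(2,3) by (intro exI[of _ "h ` A"]) (auto simp: h_def)
qed

lemma many_wide_net:
  fixes X :: "'a::metric_space set"
  assumes "compact X" "continuous_on X f" "many_wide X f x \<mu> n \<tau>" "r > 0" "4 * r \<le> \<tau>" "fine_net X f G r"
  shows "\<exists>T \<subseteq> G \<times> G \<times> UNIV. finite T \<and> card T = n \<and> wide_witness X f x \<mu> T (\<tau> - 4 * r)"
proof (rule witness_of_many_wide[OF assms(3)])
  fix C j assume "C \<in> components (in_slab X f x \<mu> j)" "\<tau> < diameter (f ` C)"
  then show "\<exists>d\<in>G. \<exists>e\<in>G. d \<in> C \<and> e \<in> C \<and> \<tau> - 4 * r < f e - f d"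
    unfolding in_slab_def by (elim wide_component_net_points[OF assms(1,2) _ _ assms(4-6)]) auto
qed

text \<open>\<open>D\<close> is a net for every radius, so the radius may depend on the component,
  and the strict inequality for its width leaves room for the loss.\<close>

lemma many_wide_iff_witness:
  fixes X :: "'a::metric_space set"
  assumes X: "compact X" "continuous_on X f" and mu: "\<mu> > 0" and tau: "\<tau> \<ge> 0"
    and D: "D \<subseteq> X" "\<And>r. r > 0 \<Longrightarrow> fine_net X f D r"
  shows "many_wide X f x \<mu> n \<tau> \<longleftrightarrow>
    (\<exists>T \<subseteq> D \<times> D \<times> UNIV. finite T \<and> card T = n \<and> wide_witness X f x \<mu> T \<tau>)"
proof
  assume m: "many_wide X f x \<mu> n \<tau>"
  show "\<exists>T \<subseteq> D \<times> D \<times> UNIV. finite T \<and> card T = n \<and> wide_witness X f x \<mu> T \<tau>"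
  proof (rule witness_of_many_wide[OF m])
    fix C j assume C: "C \<in> components (in_slab X f x \<mu> j)" and w: "\<tau> < diameter (f ` C)"
    \<comment> \<open>\<open>\<tau>'\<close> lies halfway between \<open>\<tau>\<close> and the
      width of \<open>C\<close>, and \<open>r\<close> is chosen to make
      \<open>\<tau>' - 4 * r = \<tau>\<close>.\<close>
    define \<tau>' r where "\<tau>' = (\<tau> + diameter (f ` C)) / 2" and "r = (\<tau>' - \<tau>) / 4"
    have "r > 0" "4 * r \<le> \<tau>'" "\<tau>' < diameter (f ` C)" "\<tau>' - 4 * r = \<tau>"
      using w tau by (auto simp: \<tau>'_def r_def field_simps)
    then show "\<exists>d\<in>D. \<exists>e\<in>D. d \<in> C \<and> e \<in> C \<and> \<tau> < f e - f d"
      using wide_component_net_points[OF X C[unfolded in_slab_def], of \<tau>' r D] D(2)[of r] by metis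
  qed
next
  assume "\<exists>T \<subseteq> D \<times> D \<times> UNIV. finite T \<and> card T = n \<and> wide_witness X f x \<mu> T \<tau>"
  then show "many_wide X f x \<mu> n \<tau>" using many_wide_of_witness[OF mu tau] by blast
qed

text \<open>A finite net supplies witnessing pairs for every finite family of wide components, and a
  pair \<open>(d, e)\<close> determines its slab because \<open>f d < f e\<close>. The number of
  pairs of net points thus bounds all such families, although \<open>j\<close> ranges over all
  integers.\<close>

lemma finite_wide_components:
  fixes X :: "'a::metric_space set"
  assumes X: "compact X" "locally connected X" "continuous_on X f" and mu: "\<mu> > 0" and tau: "\<tau> > 0"
  shows "finite {C \<in> strip_components X f x \<mu>. \<tau> < diameter (f ` C)}" (is "finite ?A")
proof -
  \<comment> \<open>With this radius the guaranteed difference \<open>\<tau> - 4 * r\<close> is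
    \<open>0\<close>; the count uses only that \<open>f e - f d\<close> is positive.\<close>
  have r: "0 < \<tau> / 4" "4 * (\<tau> / 4) \<le> \<tau>" using tau by auto
  obtain G where G: "finite G" "G \<subseteq> X" "fine_net X f G (\<tau> / 4)"
    by (rule finite_fine_net_exists[OF X r(1) order_refl closure_subset])
  have bound: "card A \<le> card (G \<times> G)" if A: "A \<subseteq> ?A" "finite A" for A
  proof -
    have m: "many_wide X f x \<mu> (card A) \<tau>" unfolding many_wide_def using A by blast
    from many_wide_net[OF X(1,3) m r G(3)]
    obtain T where T: "T \<subseteq> G \<times> G \<times> UNIV" "finite T" "card T = card A" "wide_witness X f x \<mu> T 0"
      by auto
    have lt: "\<not> j < j'" if "(d, e, j) \<in> T" "(d, e, j') \<in> T" for d e j j'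
    proof
      assume "j < j'"
      note st = slab_step[OF mu this, of x]
      have c: "connected_component (in_slab X f x \<mu> j) d e" "0 < f e - f d" "connected_component (in_slab X f x \<mu> j') d e"
        using T(4) that unfolding wide_witness_def by blast+
      then have "e \<in> in_slab X f x \<mu> j" "d \<in> in_slab X f x \<mu> j'" by (auto dest: connected_component_in)
      then have "f e \<le> f d" using st by (auto simp: in_slab_def level_def)
      then show False using c by simp
    qed
    have "inj_on (\<lambda>(d, e, j). (d, e)) T"
    proof (rule inj_onI)
      fix y y' assume y: "y \<in> T" "y' \<in> T" "(\<lambda>(d, e, j). (d, e)) y = (\<lambda>(d, e, j). (d, e)) y'"
      obtain d e j d' e' j' where yy: "y = (d, e, j)" "y' = (d', e', j')" by (cases y, cases y')
      with y have "(d, e, j) \<in> T" "(d, e, j') \<in> T" "d = d'" "e = e'" by auto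
      then show "y = y'" using lt[of d e j j'] lt[of d e j' j] yy by auto
    qed
    then have "card T \<le> card (G \<times> G)"
      using T(1) G(1) by (intro card_inj_on_le) auto
    then show ?thesis using T(3) by simp
  qed
  show ?thesis
  proof (rule ccontr)
    assume "infinite ?A"
    then obtain A where "finite A" "card A = Suc (card (G \<times> G))" "A \<subseteq> ?A"
      using infinite_arbitrarily_large by blast
    then show False using bound[of A] by simp
  qed
qed

subsection \<open>Stability under perturbation\<close>

text \<open>\<open>\<delta>\<close> may depend on \<open>d\<close>, \<open>e\<close> and
  \<open>j\<close>: the limit argument treats only finitely many triples at a time.\<close>

definition stable_slabs :: "'a::metric_space set \<Rightarrow> ('a \<Rightarrow> real) \<Rightarrow> 'a set \<Rightarrow> real \<Rightarrow> real \<Rightarrow> bool" where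
  "stable_slabs X f D x \<mu> \<longleftrightarrow> (\<forall>d\<in>D. \<forall>e\<in>D. \<forall>j. connected_component (in_slab X f x \<mu> j) d e \<longrightarrow>
    (\<exists>\<delta>>0. connected_component (level X f (\<mu> * (of_int j + x) + \<delta>) (\<mu> * (of_int j + 1 + x) - \<delta>)) d e))"

text \<open>Passing to net points costs \<open>4 * r\<close> of the width, and replacing
  \<open>f\<close> by \<open>g\<close> at two points another \<open>2 * r\<close>. The triples are
  kept, since both functions join the same net points in the same slabs.\<close>

lemma many_wide_transfer:
  fixes X :: "'a::metric_space set"
  assumes "compact X" "continuous_on X f" and mu: "\<mu> > 0" and r: "r > 0" "6 * r \<le> \<tau>"
    and G: "fine_net X f G r" and fg: "\<And>z. z \<in> X \<Longrightarrow> \<bar>g z - f z\<bar> \<le> r"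
    and eq: "\<And>d e j. d \<in> G \<Longrightarrow> e \<in> G \<Longrightarrow> connected_component (in_slab X f x \<mu> j) d e \<longleftrightarrow> connected_component (in_slab X g x \<mu> j) d e"
    and m: "many_wide X f x \<mu> n \<tau>"
  shows "many_wide X g x \<mu> n (\<tau> - 6 * r)"
proof -
  obtain T where T: "T \<subseteq> G \<times> G \<times> UNIV" "finite T" "card T = n" "wide_witness X f x \<mu> T (\<tau> - 4 * r)"
    using many_wide_net[OF assms(1,2) m r(1) _ G] r by auto
  have GX: "G \<subseteq> X" using G by (simp add: fine_net_def)
  have "wide_witness X g x \<mu> T (\<tau> - 6 * r)"
    unfolding wide_witness_def
  proof (intro conjI ballI)
    fix t assume "t \<in> T"
    moreover obtain d e j where t': "t = (d, e, j)" by (cases t)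
    ultimately have t: "(d, e, j) \<in> T" by simp
    then have "d \<in> G" "e \<in> G" using T(1) by auto
    moreover have "connected_component (in_slab X f x \<mu> j) d e" "\<tau> - 4 * r < f e - f d"
      using T(4) t unfolding wide_witness_def by blast+
    moreover have "\<bar>g d - f d\<bar> \<le> r" "\<bar>g e - f e\<bar> \<le> r"
      using fg calculation(1,2) GX by blast+
    ultimately have "connected_component (in_slab X g x \<mu> j) d e \<and> \<tau> - 6 * r < g e - g d"
      using eq by (auto simp: abs_le_iff)
    then show "case t of (d, e, j) \<Rightarrow> connected_component (in_slab X g x \<mu> j) d e \<and> \<tau> - 6 * r < g e - g d"
      by (simp add: t')
  next
    fix t assume t: "t \<in> T"
    obtain d e j where t': "t = (d, e, j)" by (cases t)
    show "case t of (d, e, j) \<Rightarrow> \<forall>(d', e', j')\<in>T. j = j' \<and> connected_component (in_slab X g x \<mu> j) d d' \<longrightarrow> (d, e, j) = (d', e', j')"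
      unfolding t' using t[unfolded t'] T(1) eq T(4) unfolding wide_witness_def by fast
  qed
  then show ?thesis using many_wide_of_witness[OF mu _ T(2)] T(3) r by auto
qed

text \<open>Joined points stay joined because stability joins them in a thinner slab of
  \<open>f\<close>, which lies in the slab of \<open>g n\<close>. Unjoined points stay unjoined
  because they are so already in a thicker slab of \<open>f\<close>, which contains the slab of
  \<open>g n\<close>.\<close>

lemma eventually_same_slab_components:
  fixes X :: "'a::metric_space set" and F :: "'b filter"
  assumes X: "compact X" "continuous_on X f" and mu: "\<mu> > 0"
    and st: "stable_slabs X f D x \<mu>" and G: "finite G" "G \<subseteq> D" and GX: "D \<subseteq> X"
    and lim: "uniform_limit X g f F"
  shows "\<forall>\<^sub>F n in F. \<forall>d\<in>G. \<forall>e\<in>G. \<forall>j.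
    connected_component (in_slab X f x \<mu> j) d e \<longleftrightarrow> connected_component (in_slab X (g n) x \<mu> j) d e"
proof (intro eventually_ball_finite[OF G(1)] ballI)
  have near: "\<forall>\<^sub>F n in F. \<forall>z\<in>X. \<bar>g n z - f z\<bar> \<le> e" if "e > 0" for e
    using uniform_limitD[OF lim that] by (rule eventually_mono) (auto simp: dist_real_def intro: less_imp_le)
  fix d e assume d: "d \<in> G" and e: "e \<in> G"
  \<comment> \<open>Only these finitely many slabs come within \<open>1\<close> of the value
    \<open>f d\<close>. Once \<open>g n\<close> is within \<open>1\<close> of \<open>f\<close>, no
    other slab contains \<open>d\<close> for either function, so both sides are false there.\<close>
  define J where "J = {j. \<mu> * (of_int j + x) \<le> f d + 1 \<and> f d - 1 \<le> \<mu> * (of_int j + 1 + x)}"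
  have "J \<subseteq> {\<lfloor>(f d - 1) / \<mu> - 1 - x\<rfloor>..\<lceil>(f d + 1) / \<mu> - x\<rceil>}"
  proof
    fix j assume "j \<in> J"
    then have "of_int j \<le> (f d + 1) / \<mu> - x" "(f d - 1) / \<mu> - 1 - x \<le> of_int j"
      using mu by (auto simp: J_def field_simps)
    then show "j \<in> {\<lfloor>(f d - 1) / \<mu> - 1 - x\<rfloor>..\<lceil>(f d + 1) / \<mu> - x\<rceil>}"
      by (simp add: floor_le_iff le_ceiling_iff)
  qed
  then have J: "finite J" by (rule finite_subset) simp
  have "\<forall>\<^sub>F n in F. \<forall>j\<in>J. connected_component (in_slab X f x \<mu> j) d e \<longleftrightarrow> connected_component (in_slab X (g n) x \<mu> j) d e"
  proof (intro eventually_ball_finite[OF J] ballI)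
    fix j
    show "\<forall>\<^sub>F n in F. connected_component (in_slab X f x \<mu> j) d e \<longleftrightarrow> connected_component (in_slab X (g n) x \<mu> j) d e"
    proof (cases "connected_component (in_slab X f x \<mu> j) d e")
      case True
      then obtain \<delta> where \<delta>: "\<delta> > 0" "connected_component (level X f (\<mu> * (of_int j + x) + \<delta>) (\<mu> * (of_int j + 1 + x) - \<delta>)) d e"
        using st d e G unfolding stable_slabs_def by blast
      show ?thesis
        using near[OF \<delta>(1)]
      proof eventually_elim
        case (elim n)
        then show ?case
          using True connected_component_of_subset[OF \<delta>(2) level_mono[where g="g n" and e=\<delta>]]
          unfolding in_slab_def by simp
      qed
    next
      case False
      then obtain \<delta> where \<delta>: "\<delta> > 0" "\<not> connected_component (level X f (\<mu> * (of_int j + x) - \<delta>) (\<mu> * (of_int j + 1 + x) + \<delta>)) d e"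
        using connected_component_level_limit[OF X] unfolding in_slab_def by blast
      show ?thesis
        using near[OF \<delta>(1)]
      proof eventually_elim
        case (elim n)
        have "level X (g n) (\<mu> * (of_int j + x)) (\<mu> * (of_int j + 1 + x)) \<subseteq>
            level X f (\<mu> * (of_int j + x) - \<delta>) (\<mu> * (of_int j + 1 + x) + \<delta>)"
          using elim by (intro level_mono[where e=\<delta>]) (auto simp: abs_minus_commute)
        then show ?case
          using False \<delta>(2) connected_component_of_subset unfolding in_slab_def by metis
      qed
    qed
  qed
  with near[OF zero_less_one] show "\<forall>\<^sub>F n in F. \<forall>j. connected_component (in_slab X f x \<mu> j) d e \<longleftrightarrow> connected_component (in_slab X (g n) x \<mu> j) d e"
  proof eventually_elim
    case (elim n)
    have dX: "d \<in> X" using d G GX by blast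
    show ?case
    proof
      fix j
      show "connected_component (in_slab X f x \<mu> j) d e \<longleftrightarrow> connected_component (in_slab X (g n) x \<mu> j) d e"
      proof (cases "j \<in> J")
        case False
        then have "d \<notin> in_slab X f x \<mu> j" "d \<notin> in_slab X (g n) x \<mu> j"
          using elim(1) dX by (auto simp: J_def in_slab_def level_def abs_le_iff)
        then show ?thesis by (meson connected_component_in)
      qed (use elim in blast)
    qed
  qed
qed

subsection \<open>Decreasing enumerations\<close>

text \<open>Each member is ranked by the number of members preceding it, which is finite since only
  finitely many are wider than a given positive bound; the enumeration inverts the rank.\<close>

lemma decreasing_enumeration_exists:
  fixes w :: "'b \<Rightarrow> real"
  assumes pos: "\<And>C. C \<in> F \<Longrightarrow> w C > 0" and fin: "\<And>e. e > 0 \<Longrightarrow> finite {C \<in> F. e < w C}"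
  shows "\<exists>C. decreasing_enumeration w F C"
proof -
  have "F \<subseteq> (\<Union>n. {C \<in> F. 1 / Suc n < w C})"
  proof
    fix C assume "C \<in> F"
    then show "C \<in> (\<Union>n. {C \<in> F. 1 / Suc n < w C})"
      using nat_approx_posE[OF pos[of C]] by blast
  qed
  moreover have "countable (\<Union>n. {C \<in> F. 1 / Suc n < w C})"
    using fin by (intro countable_UN) (auto intro: countable_finite)
  ultimately have cF: "countable F" by (rule countable_subset)
  define idx where "idx = to_nat_on F"
  have idx: "inj_on idx F" unfolding idx_def using cF by (rule inj_on_to_nat_on)
  \<comment> \<open>Ties in width are broken by an enumeration of the countable set
    \<open>F\<close>, which makes this a strict linear order on \<open>F\<close>.\<close>
  define before where "before C' C \<longleftrightarrow> w C' > w C \<or> (w C' = w C \<and> idx C' < idx C)" for C' C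
  define seg where "seg C = {C' \<in> F. before C' C}" for C
  define rank where "rank C = card (seg C)" for C
  have fseg: "finite (seg C)" if "C \<in> F" for C
    using pos[OF that] by (intro finite_subset[OF _ fin[of "w C / 2"]]) (auto simp: seg_def before_def)
  have less: "rank C' < rank C" if "C \<in> F" "C' \<in> F" "before C' C" for C C'
    unfolding rank_def
  proof (rule psubset_card_mono[OF fseg[OF that(1)]])
    have "seg C' \<subseteq> seg C" using that(3) by (auto simp: seg_def before_def)
    moreover have "C' \<in> seg C" using that by (simp add: seg_def)
    moreover have "C' \<notin> seg C'" by (simp add: seg_def before_def)
    ultimately show "seg C' \<subset> seg C" by blast
  qed
  have inj: "inj_on rank F"
  proof (rule inj_onI, rule ccontr)
    fix C C' assume "C \<in> F" "C' \<in> F" "rank C = rank C'" "C \<noteq> C'"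
    moreover from this have "idx C \<noteq> idx C'" using idx by (auto dest: inj_onD)
    then have "before C C' \<or> before C' C" by (auto simp: before_def)
    ultimately show False using less by (metis less_irrefl)
  qed
  \<comment> \<open>There are \<open>rank C\<close> predecessors, with distinct ranks below
    \<open>rank C\<close>, so they attain all these values. Hence the ranks form an initial segment
    of the natural numbers.\<close>
  have seg_rank: "rank ` seg C = {..<rank C}" if "C \<in> F" for C
  proof (rule card_subset_eq)
    show "rank ` seg C \<subseteq> {..<rank C}" using less that by (auto simp: seg_def)
    have "inj_on rank (seg C)" using inj by (rule inj_on_subset) (auto simp: seg_def)
    from card_image[OF this] show "card (rank ` seg C) = card {..<rank C}"
      by (simp only: rank_def[of C] card_lessThan)
  qed simp
  have sub: "{..<rank C} \<subseteq> rank ` F" if "C \<in> F" for C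
    unfolding seg_rank[OF that, symmetric] by (auto simp: seg_def)
  have img: "rank ` F = enum_index F"
  proof (cases "finite F")
    case True
    have "rank ` F \<subseteq> {..<card F}"
      using True by (auto simp: rank_def seg_def before_def intro!: psubset_card_mono)
    then have "rank ` F = {..<card F}"
      using card_image[OF inj] by (intro card_subset_eq) auto
    then show ?thesis using True by (simp add: enum_index_def)
  next
    case False
    then have "infinite (rank ` F)" using inj finite_imageD by blast
    have "n \<in> rank ` F" for n
    proof -
      obtain C where "C \<in> F" "n < rank C"
        using \<open>infinite (rank ` F)\<close> unfolding infinite_nat_iff_unbounded by blast
      then show ?thesis using sub by blast
    qed
    then show ?thesis using False by (auto simp: enum_index_def)
  qed
  have bij: "bij_betw rank F (enum_index F)" using inj img by (simp add: bij_betw_def)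
  define C where "C = inv_into F rank"
  have C: "C k \<in> F" "rank (C k) = k" if "k \<in> enum_index F" for k
    using that unfolding C_def img[symmetric] by (auto simp: inv_into_into f_inv_into_f)
  have "w (C (Suc k)) \<le> w (C k)" if k: "Suc k \<in> enum_index F" for k
  proof (rule ccontr)
    assume "\<not> w (C (Suc k)) \<le> w (C k)"
    then have b: "before (C (Suc k)) (C k)" by (simp add: before_def)
    have k': "k \<in> enum_index F" using k by (auto simp: enum_index_def split: if_splits)
    show False using less[OF C(1)[OF k'] C(1)[OF k] b] C(2)[OF k] C(2)[OF k'] by simp
  qed
  then show ?thesis
    unfolding decreasing_enumeration_def C_def using bij_betw_inv_into[OF bij] by blast
qed

text \<open>The right-hand side does not mention \<open>C\<close>, so later arguments are
  independent of the chosen enumeration. Since \<open>t \<ge> 0\<close>, the default value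
  \<open>0\<close> of a missing term never exceeds \<open>t\<close>.\<close>

lemma decreasing_enumeration_gt_iff:
  assumes C: "decreasing_enumeration w F C" and t: "t \<ge> 0"
  shows "t < (if k \<in> enum_index F then w (C k) else 0) \<longleftrightarrow>
    (\<exists>A \<subseteq> F. finite A \<and> card A = Suc k \<and> (\<forall>B\<in>A. t < w B))"
proof -
  have bij: "bij_betw C (enum_index F) F"
    and step: "\<And>k. Suc k \<in> enum_index F \<Longrightarrow> w (C (Suc k)) \<le> w (C k)"
    using C by (auto simp: decreasing_enumeration_def)
  have down: "k \<in> enum_index F" if "m \<in> enum_index F" "k \<le> m" for k m
    using that by (auto simp: enum_index_def split: if_splits)
  have anti: "w (C m) \<le> w (C k)" if "m \<in> enum_index F" "k \<le> m" for k m
    using that(2,1)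
  proof (induction m rule: dec_induct)
    case (step n)
    then show ?case using down[of "Suc n" n] assms(1) by (auto simp: decreasing_enumeration_def intro: order_trans)
  qed simp
  show ?thesis
  proof
    assume *: "t < (if k \<in> enum_index F then w (C k) else 0)"
    then have k: "k \<in> enum_index F" "t < w (C k)" using t by (auto split: if_splits)
    have sub: "{..k} \<subseteq> enum_index F" using down k by auto
    then have "inj_on C {..k}" using bij by (auto simp: bij_betw_def intro: inj_on_subset)
    then have "card (C ` {..k}) = Suc k" by (simp add: card_image)
    moreover have "C ` {..k} \<subseteq> F" using sub bij by (auto simp: bij_betw_def)
    moreover have "\<forall>B\<in>C ` {..k}. t < w B" using anti[OF k(1)] k(2) by fastforce
    ultimately show "\<exists>A \<subseteq> F. finite A \<and> card A = Suc k \<and> (\<forall>B\<in>A. t < w B)"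
      by (intro exI[of _ "C ` {..k}"]) auto
  next
    assume "\<exists>A \<subseteq> F. finite A \<and> card A = Suc k \<and> (\<forall>B\<in>A. t < w B)"
    then obtain A where A: "A \<subseteq> F" "finite A" "card A = Suc k" "\<forall>B\<in>A. t < w B" by blast
    obtain I where I: "I \<subseteq> enum_index F" "A = C ` I"
      using A(1) bij by (metis bij_betw_imp_surj_on subset_imageE)
    have "inj_on C I" using bij I(1) by (auto simp: bij_betw_def intro: inj_on_subset)
    then have "card I = Suc k" using A(3) I(2) by (simp add: card_image)
    \<comment> \<open>Among \<open>Suc k\<close> distinct indices one is at least \<open>k\<close>,
      and by monotonicity the width at index \<open>k\<close> is no smaller than the width
      there.\<close>
    then have "\<not> I \<subseteq> {..<k}" using card_mono[of "{..<k}" I] by auto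
    then obtain i where i: "i \<in> I" "k \<le> i" by (metis lessThan_iff not_less subsetI)
    then have "i \<in> enum_index F" using I by blast
    then show "t < (if k \<in> enum_index F then w (C k) else 0)"
      using down[of i k] anti[of i k] i A(4) I(2) by force
  qed
qed

subsection \<open>The terms of the slab length\<close>

definition piece_width :: "'a::metric_space set \<Rightarrow> ('a \<Rightarrow> real) \<Rightarrow> real \<Rightarrow> real \<Rightarrow> nat \<Rightarrow> real" where
  "piece_width X f x \<mu> k =
    (let F = strip_components X f x \<mu>; w = (\<lambda>C. diameter (f ` C)) in
     if k \<in> enum_index F then w ((SOME C. decreasing_enumeration w F C) k) else 0)"

lemma slab_length_eq:
  "slab_length X \<gamma> x u \<mu> = (\<Sum>k. piece_width X (\<lambda>p. \<gamma> p \<bullet> u) x \<mu> k / 2 ^ k)"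
  unfolding slab_length_def piece_width_def Let_def slab_components_eq width_def image_image
  by (intro arg_cong[where f = suminf] ext) simp

section \<open>Bounds and convergence of the terms\<close>

lemma width_in_slab_le:
  assumes "C \<in> components (in_slab X f x \<mu> j)"
  shows "diameter (f ` C) \<le> max 0 \<mu>"
proof (rule diameter_le)
  have C: "C \<subseteq> in_slab X f x \<mu> j" using assms by (rule in_components_subset)
  fix a b assume "a \<in> f ` C" "b \<in> f ` C"
  then have "\<mu> * (of_int j + x) \<le> a \<and> a \<le> \<mu> * (of_int j + x) + \<mu>" "\<mu> * (of_int j + x) \<le> b \<and> b \<le> \<mu> * (of_int j + x) + \<mu>"
    using C by (auto simp: in_slab_def level_def algebra_simps)
  then show "norm (a - b) \<le> max 0 \<mu>" by auto
qed simp

lemma strip_components_width: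
  assumes "C \<in> strip_components X f x \<mu>"
  shows "0 < diameter (f ` C)" "diameter (f ` C) \<le> max 0 \<mu>"
  using assms width_in_slab_le unfolding strip_components_def by blast+

lemma strip_components_empty:
  assumes "\<mu> \<le> 0"
  shows "strip_components X f x \<mu> = {}"
proof -
  have False if "C \<in> strip_components X f x \<mu>" for C
    using strip_components_width[OF that] assms by linarith
  then show ?thesis by blast
qed

text \<open>The measurability statements range over all real \<open>\<mu>\<close>, so degenerate
  thicknesses need to be covered as well.\<close>

lemma piece_width_nonpos: "\<mu> \<le> 0 \<Longrightarrow> piece_width X f x \<mu> k = 0"
  by (simp add: piece_width_def strip_components_empty enum_index_def)

text \<open>Finiteness of the wide components provides a decreasing enumeration. Convergence and
  measurability of the terms are both reduced to counting in this way.\<close>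

lemma piece_width_gt_iff:
  fixes X :: "'a::metric_space set"
  assumes "compact X" "locally connected X" "continuous_on X f" "\<mu> > 0" "\<tau> \<ge> 0"
  shows "\<tau> < piece_width X f x \<mu> k \<longleftrightarrow> many_wide X f x \<mu> (Suc k) \<tau>"
proof -
  have "\<exists>C. decreasing_enumeration (\<lambda>C. diameter (f ` C)) (strip_components X f x \<mu>) C"
    using finite_wide_components[OF assms(1-4)]
    by (intro decreasing_enumeration_exists) (auto simp: strip_components_def)
  from decreasing_enumeration_gt_iff[OF someI_ex[OF this] assms(5)] show ?thesis
    unfolding piece_width_def many_wide_def Let_def by blast
qed

lemma piece_width_bounds:
  fixes X :: "'a::metric_space set"
  assumes "compact X" "locally connected X" "continuous_on X f"
  shows "0 \<le> piece_width X f x \<mu> k" "piece_width X f x \<mu> k \<le> max 0 \<mu>"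
proof -
  have "piece_width X f x \<mu> k \<le> max 0 \<mu> \<and> 0 \<le> piece_width X f x \<mu> k"
  proof (cases "\<mu> > 0")
    case True
    note gt = piece_width_gt_iff[OF assms True]
    have ex: "\<exists>C. decreasing_enumeration (\<lambda>C. diameter (f ` C)) (strip_components X f x \<mu>) C"
      using finite_wide_components[OF assms True]
      by (intro decreasing_enumeration_exists) (auto simp: strip_components_def)
    have "\<not> many_wide X f x \<mu> (Suc k) \<mu>"
    proof
      assume "many_wide X f x \<mu> (Suc k) \<mu>"
      then obtain A where A: "A \<subseteq> strip_components X f x \<mu>" "card A = Suc k" "\<forall>C\<in>A. \<mu> < diameter (f ` C)"
        unfolding many_wide_def by blast
      then obtain C where "C \<in> A" by fastforce
      then show False
        using A(1,3) strip_components_width(2)[of C X f x \<mu>] True by (metis leD max.absorb2 less_imp_le subsetD)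
    qed
    then have "\<not> \<mu> < piece_width X f x \<mu> k" using gt[of \<mu>] True by simp
    moreover have "0 \<le> piece_width X f x \<mu> k"
    proof (cases "k \<in> enum_index (strip_components X f x \<mu>)")
      case True
      let ?C = "SOME C. decreasing_enumeration (\<lambda>C. diameter (f ` C)) (strip_components X f x \<mu>) C"
      have "?C k \<in> strip_components X f x \<mu>"
        using someI_ex[OF ex] True unfolding decreasing_enumeration_def by (metis (no_types, lifting) bij_betw_apply)
      then show ?thesis
        using strip_components_width(1)[of "?C k"] True by (simp add: piece_width_def less_imp_le)
    qed (simp add: piece_width_def)
    ultimately show ?thesis using True by simp
  qed (simp add: piece_width_nonpos)
  then show "0 \<le> piece_width X f x \<mu> k" "piece_width X f x \<mu> k \<le> max 0 \<mu>" by auto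
qed

lemma fine_net_radius_mono: "fine_net X f G r \<Longrightarrow> r \<le> r' \<Longrightarrow> fine_net X f G r'"
  for r :: real
  unfolding fine_net_def by (meson order_less_le_trans)

text \<open>Eventually \<open>f\<close> and \<open>g n\<close> join the same points of a finite net
  in the same slabs. Transferring the counts in both directions bounds the difference of the terms
  by \<open>6 * r\<close>.\<close>

lemma piece_width_tendsto:
  fixes X :: "'a::metric_space set"
  assumes X: "compact X" "locally connected X" and f: "continuous_on X f" and g: "\<And>n. continuous_on X (g n)"
    and mu: "\<mu> > 0" and D: "D \<subseteq> X" "X \<subseteq> closure D" and st: "stable_slabs X f D x \<mu>"
    and lim: "uniform_limit X g f F"
  shows "((\<lambda>n. piece_width X (g n) x \<mu> k) \<longlongrightarrow> piece_width X f x \<mu> k) F"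
proof (rule tendstoI)
  fix e :: real assume e: "e > 0"
  \<comment> \<open>\<open>6 * r = e / 2\<close> is below \<open>e\<close>, and a net of radius
    \<open>r / 3\<close> for \<open>f\<close> has radius \<open>r / 3 + 2 * (r / 3) = r\<close> for
    \<open>g n\<close>.\<close>
  define r where "r = e / 12"
  have r: "r > 0" "r / 3 > 0" using e by (auto simp: r_def)
  obtain G where G: "finite G" "G \<subseteq> D" "fine_net X f G (r / 3)"
    by (rule finite_fine_net_exists[OF X f r(2) D])
  have near: "\<forall>\<^sub>F n in F. \<forall>z\<in>X. \<bar>g n z - f z\<bar> < r / 3"
    using uniform_limitD[OF lim r(2)] by (simp add: dist_real_def)
  show "\<forall>\<^sub>F n in F. dist (piece_width X (g n) x \<mu> k) (piece_width X f x \<mu> k) < e"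
    using near eventually_same_slab_components[OF X(1) f mu st G(1,2) D(1) lim]
  proof eventually_elim
    case (elim n)
    have fg: "\<bar>g n z - f z\<bar> \<le> r / 3" "\<bar>g n z - f z\<bar> \<le> r" "\<bar>f z - g n z\<bar> \<le> r" if "z \<in> X" for z
      using elim(1) that r by (auto simp: abs_minus_commute less_imp_le intro: order_trans[OF less_imp_le])
    have netg: "fine_net X (g n) G r"
      using fine_net_perturb[OF G(3) fg(1)] by simp
    have netf: "fine_net X f G r" using fine_net_radius_mono[OF G(3)] r by simp
    let ?a = "piece_width X f x \<mu> k" and ?b = "piece_width X (g n) x \<mu> k"
    have a0: "0 \<le> ?a" and b0: "0 \<le> ?b"
      using piece_width_bounds(1)[OF X] f g by auto
    have "\<not> ?b + 6 * r < ?a"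
    proof
      assume "?b + 6 * r < ?a"
      then have "many_wide X f x \<mu> (Suc k) (?b + 6 * r)"
        using piece_width_gt_iff[OF X f mu] b0 r by simp
      from many_wide_transfer[OF X(1) f mu r(1) _ netf fg(2) _ this] elim(2) b0
      have "many_wide X (g n) x \<mu> (Suc k) ?b" by simp
      then show False using piece_width_gt_iff[OF X g mu b0] by blast
    qed
    moreover have "\<not> ?a + 6 * r < ?b"
    proof
      assume "?a + 6 * r < ?b"
      then have "many_wide X (g n) x \<mu> (Suc k) (?a + 6 * r)"
        using piece_width_gt_iff[OF X g mu] a0 r by simp
      from many_wide_transfer[OF X(1) g mu r(1) _ netg fg(3) _ this] elim(2) a0
      have "many_wide X f x \<mu> (Suc k) ?a" by simp
      then show False using piece_width_gt_iff[OF X f mu a0] by blast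
    qed
    ultimately show ?case using e by (auto simp: dist_real_def r_def abs_less_iff)
  qed
qed

lemma div_power2_sums: "(\<lambda>k. c / 2 ^ k) sums (2 * c)" for c :: real
proof -
  have "(\<lambda>k. c * (1 / 2) ^ k) sums (c * (1 / (1 - 1 / 2)))"
    by (intro sums_mult geometric_sums) simp
  moreover have "(\<lambda>k. c / 2 ^ k) = (\<lambda>k. c * (1 / 2) ^ k)" by (simp add: power_divide)
  moreover have "2 * c = c * (1 / (1 - 1 / 2))" by simp
  ultimately show ?thesis by metis
qed

lemma slab_length_bounds:
  fixes X :: "'a::metric_space set" and \<gamma> :: "'a \<Rightarrow> real ^ 'n"
  assumes "compact X" "locally connected X" "continuous_on X \<gamma>"
  shows "0 \<le> slab_length X \<gamma> x u \<mu>" "slab_length X \<gamma> x u \<mu> \<le> 2 * max 0 \<mu>"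
proof -
  have f: "continuous_on X (\<lambda>p. \<gamma> p \<bullet> u)" using assms(3) by (intro continuous_intros)
  note b = piece_width_bounds[OF assms(1,2) f, of x \<mu>]
  have s: "summable (\<lambda>k. piece_width X (\<lambda>p. \<gamma> p \<bullet> u) x \<mu> k / 2 ^ k)"
    by (rule summable_comparison_test_ev[OF always_eventually sums_summable[OF div_power2_sums[of "max 0 \<mu>"]]])
      (use b in \<open>auto intro: divide_right_mono\<close>)
  show "0 \<le> slab_length X \<gamma> x u \<mu>"
    unfolding slab_length_eq using b by (intro suminf_nonneg s) auto
  have "slab_length X \<gamma> x u \<mu> \<le> (\<Sum>k. max 0 \<mu> / 2 ^ k)"
    unfolding slab_length_eq using b by (intro suminf_le s sums_summable[OF div_power2_sums] divide_right_mono) auto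
  also have "\<dots> = 2 * max 0 \<mu>" by (rule sums_unique[OF div_power2_sums, symmetric])
  finally show "slab_length X \<gamma> x u \<mu> \<le> 2 * max 0 \<mu>" .
qed

text \<open>The terms converge one by one and are dominated by \<open>max 0 \<mu> / 2 ^ k\<close>,
  so Tannery's theorem applies.\<close>

lemma slab_length_tendsto:
  fixes X :: "'a::metric_space set" and \<gamma> :: "'a \<Rightarrow> real ^ 'n"
  assumes X: "compact X" "locally connected X" and \<gamma>: "continuous_on X \<gamma>" "\<And>n. continuous_on X (\<gamma>' n)"
    and mu: "\<mu> > 0" and D: "D \<subseteq> X" "X \<subseteq> closure D" and st: "stable_slabs X (\<lambda>p. \<gamma> p \<bullet> u) D x \<mu>"
    and lim: "uniform_limit X \<gamma>' \<gamma> sequentially"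
  shows "(\<lambda>n. slab_length X (\<gamma>' n) x u \<mu>) \<longlonglongrightarrow> slab_length X \<gamma> x u \<mu>"
proof -
  have c: "continuous_on X (\<lambda>p. \<gamma> p \<bullet> u)" "continuous_on X (\<lambda>p. \<gamma>' n p \<bullet> u)" for n
    using \<gamma> by (auto intro!: continuous_intros)
  have lim': "uniform_limit X (\<lambda>n p. \<gamma>' n p \<bullet> u) (\<lambda>p. \<gamma> p \<bullet> u) sequentially"
    using bounded_linear.uniform_limit[OF bounded_linear_inner_left lim] .
  have "norm (piece_width X (\<lambda>p. \<gamma>' n p \<bullet> u) x \<mu> k / 2 ^ k) \<le> max 0 \<mu> / 2 ^ k" for k n
    using piece_width_bounds[OF X c(2)] by (auto intro: divide_right_mono)
  then have "\<forall>\<^sub>F (k, n) in sequentially \<times>\<^sub>F sequentially.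
      norm (piece_width X (\<lambda>p. \<gamma>' n p \<bullet> u) x \<mu> k / 2 ^ k) \<le> max 0 \<mu> / 2 ^ k"
    by (intro always_eventually) auto
  from tannerys_theorem[OF tendsto_divide[OF piece_width_tendsto[OF X c mu D st lim'] tendsto_const] this sums_summable[OF div_power2_sums]]
  show ?thesis unfolding slab_length_eq by simp
qed

subsection \<open>Measurability\<close>

text \<open>By Cauchy-Schwarz, a change of direction is a uniform perturbation of the scalar
  function.\<close>

lemma uniform_limit_inner:
  fixes \<gamma> :: "'a \<Rightarrow> real ^ 'n"
  assumes "bounded (\<gamma> ` X)" "v \<longlonglongrightarrow> u"
  shows "uniform_limit X (\<lambda>n p. \<gamma> p \<bullet> v n) (\<lambda>p. \<gamma> p \<bullet> u) sequentially"
proof (rule uniform_limitI)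
  fix e :: real assume e: "e > 0"
  obtain B where B: "B > 0" "\<And>z. z \<in> X \<Longrightarrow> norm (\<gamma> z) \<le> B"
    using assms(1) unfolding bounded_pos by blast
  have "\<forall>\<^sub>F n in sequentially. dist (v n) u < e / B"
    using e B(1) by (intro tendstoD[OF assms(2)]) simp
  then show "\<forall>\<^sub>F n in sequentially. \<forall>z\<in>X. dist (\<gamma> z \<bullet> v n) (\<gamma> z \<bullet> u) < e"
  proof eventually_elim
    case (elim n)
    have "dist (\<gamma> z \<bullet> v n) (\<gamma> z \<bullet> u) < e" if "z \<in> X" for z
    proof -
      have "dist (\<gamma> z \<bullet> v n) (\<gamma> z \<bullet> u) = \<bar>\<gamma> z \<bullet> (v n - u)\<bar>" by (simp add: inner_diff_right dist_real_def)
      also have "\<dots> \<le> norm (\<gamma> z) * norm (v n - u)" by (rule Cauchy_Schwarz_ineq2)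
      also have "\<dots> \<le> B * norm (v n - u)" using B(2)[OF that] by (intro mult_right_mono) auto
      also have "\<dots> < e" using elim B(1) by (simp add: dist_norm field_simps)
      finally show ?thesis .
    qed
    then show ?case by blast
  qed
qed

text \<open>For parameters near \<open>l\<close> the level set lies in a slight thickening of the
  one at \<open>l\<close>, so being joined passes to the limit. The parameter is general: it is
  \<open>(x, u, \<mu>)\<close> for measurability, and a midline with a thickness for
  stability.\<close>

lemma closed_connected_component_level:
  fixes X :: "'a::metric_space set" and f :: "'b::metric_space \<Rightarrow> 'a \<Rightarrow> real"
  assumes X: "compact X" "\<And>\<theta>. continuous_on X (f \<theta>)"
    and c: "continuous_on UNIV s" "continuous_on UNIV t"
    and f: "\<And>\<theta> l. \<theta> \<longlonglongrightarrow> l \<Longrightarrow> uniform_limit X (\<lambda>n. f (\<theta> n)) (f l) sequentially"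
  shows "closed {\<theta>. connected_component (level X (f \<theta>) (s \<theta>) (t \<theta>)) d e}"
  unfolding closed_sequential_limits
proof (intro allI impI, elim conjE)
  fix \<theta> l assume th: "\<forall>n. \<theta> n \<in> {\<theta>. connected_component (level X (f \<theta>) (s \<theta>) (t \<theta>)) d e}"
    and lim: "\<theta> \<longlonglongrightarrow> l"
  have cl: "(\<lambda>n. s (\<theta> n)) \<longlonglongrightarrow> s l" "(\<lambda>n. t (\<theta> n)) \<longlonglongrightarrow> t l"
    using continuous_on_tendsto_compose[OF c(1) lim] continuous_on_tendsto_compose[OF c(2) lim] by simp_all
  have "connected_component (level X (f l) (s l) (t l)) d e"
  proof (rule connected_component_level_limit[OF X])
    fix r :: real assume "r > 0"
    \<comment> \<open>One half of \<open>r\<close> absorbs the motion of the endpoints, the other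
      half that of the function.\<close>
    then have r: "r / 2 > 0" by simp
    have "\<forall>\<^sub>F n in sequentially. dist (s (\<theta> n)) (s l) < r / 2 \<and> dist (t (\<theta> n)) (t l) < r / 2 \<and>
        (\<forall>z\<in>X. dist (f (\<theta> n) z) (f l z) < r / 2)"
      by (intro eventually_conj tendstoD[OF cl(1) r] tendstoD[OF cl(2) r] uniform_limitD[OF f[OF lim] r])
    then obtain n where n: "dist (s (\<theta> n)) (s l) < r / 2" "dist (t (\<theta> n)) (t l) < r / 2"
      "\<And>z. z \<in> X \<Longrightarrow> dist (f (\<theta> n) z) (f l z) < r / 2"
      by (auto simp: eventually_sequentially)
    have "level X (f (\<theta> n)) (s (\<theta> n)) (t (\<theta> n)) \<subseteq> level X (f l) (s l - r) (t l + r)"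
    proof (rule level_mono[where e="r / 2"])
      show "\<bar>f l z - f (\<theta> n) z\<bar> \<le> r / 2" if "z \<in> X" for z
        using n(3)[OF that] unfolding dist_real_def by linarith
      show "s l - r \<le> s (\<theta> n) - r / 2" "t (\<theta> n) + r / 2 \<le> t l + r"
        using n(1,2) unfolding dist_real_def by linarith+
    qed
    moreover have "connected_component (level X (f (\<theta> n)) (s (\<theta> n)) (t (\<theta> n))) d e" using th by simp
    ultimately show "connected_component (level X (f l) (s l - r) (t l + r)) d e"
      by (rule connected_component_of_subset[rotated])
  qed
  then show "l \<in> {\<theta>. connected_component (level X (f \<theta>) (s \<theta>) (t \<theta>)) d e}" by simp
qed

text \<open>For finite \<open>T\<close> this is a finite Boolean combination of closed conditions
  and of strict inequalities between continuous functions of the parameter.\<close>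

lemma pred_wide_witness:
  fixes X :: "'a::metric_space set" and \<gamma> :: "'a \<Rightarrow> real ^ 'n"
  assumes X: "compact X" "continuous_on X \<gamma>" and T: "finite T"
  shows "Measurable.pred borel (\<lambda>\<theta> :: real \<times> (real ^ 'n) \<times> real.
    wide_witness X (\<lambda>p. \<gamma> p \<bullet> fst (snd \<theta>)) (fst \<theta>) (snd (snd \<theta>)) T \<tau>)"
proof -
  have cc[measurable]: "Measurable.pred borel (\<lambda>\<theta> :: real \<times> (real ^ 'n) \<times> real.
      connected_component (in_slab X (\<lambda>p. \<gamma> p \<bullet> fst (snd \<theta>)) (fst \<theta>) (snd (snd \<theta>)) j) d e)" for j d e
  proof -
    have "closed {\<theta> :: real \<times> (real ^ 'n) \<times> real.
        connected_component (in_slab X (\<lambda>p. \<gamma> p \<bullet> fst (snd \<theta>)) (fst \<theta>) (snd (snd \<theta>)) j) d e}"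
      unfolding in_slab_def
    proof (rule closed_connected_component_level[OF X(1)])
      show "continuous_on X (\<lambda>p. \<gamma> p \<bullet> fst (snd \<theta>))" for \<theta> :: "real \<times> (real ^ 'n) \<times> real"
        using X(2) by (intro continuous_intros)
      fix \<theta> and l :: "real \<times> (real ^ 'n) \<times> real" assume "\<theta> \<longlonglongrightarrow> l"
      then show "uniform_limit X (\<lambda>n p. \<gamma> p \<bullet> fst (snd (\<theta> n))) (\<lambda>p. \<gamma> p \<bullet> fst (snd l)) sequentially"
        by (intro uniform_limit_inner compact_imp_bounded[OF compact_continuous_image[OF X(2,1)]] tendsto_intros)
    qed (intro continuous_intros)+
    then show ?thesis by (simp add: pred_def borel_closed)
  qed
  have w[measurable]: "(\<lambda>\<theta> :: real \<times> (real ^ 'n) \<times> real. \<gamma> d \<bullet> fst (snd \<theta>)) \<in> borel_measurable borel" for d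
    by (intro borel_measurable_continuous_onI continuous_intros)
  show ?thesis
    unfolding wide_witness_def split_beta
    by (intro pred_intros_logic pred_intros_finite T) measurable
qed

text \<open>For \<open>\<mu> > 0\<close> the width exceeds \<open>a \<ge> 0\<close> iff there is a
  witness made of points of \<open>D\<close>, and there are only countably many finite sets of such
  triples.\<close>

lemma borel_measurable_piece_width:
  fixes X :: "'a::metric_space set" and \<gamma> :: "'a \<Rightarrow> real ^ 'n"
  assumes X: "compact X" "locally connected X" "continuous_on X \<gamma>"
    and D: "countable D" "D \<subseteq> X" "X \<subseteq> closure D"
  shows "(\<lambda>\<theta> :: real \<times> (real ^ 'n) \<times> real. piece_width X (\<lambda>p. \<gamma> p \<bullet> fst (snd \<theta>)) (fst \<theta>) (snd (snd \<theta>)) k)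
    \<in> borel_measurable borel"
  unfolding borel_measurable_iff_greater
proof
  fix a :: real
  let ?pw = "\<lambda>\<theta> :: real \<times> (real ^ 'n) \<times> real. piece_width X (\<lambda>p. \<gamma> p \<bullet> fst (snd \<theta>)) (fst \<theta>) (snd (snd \<theta>)) k"
  define \<T> where "\<T> = {T. T \<subseteq> D \<times> D \<times> (UNIV :: int set) \<and> finite T \<and> card T = Suc k}"
  have c\<T>: "countable \<T>"
    by (rule countable_subset[OF _ countable_Collect_finite_subset[of "D \<times> D \<times> (UNIV :: int set)"]])
      (use D(1) in \<open>auto simp: \<T>_def\<close>)
  have f: "continuous_on X (\<lambda>p. \<gamma> p \<bullet> u)" for u using X(3) by (intro continuous_intros)
  have net: "fine_net X (\<lambda>p. \<gamma> p \<bullet> u) D r" if r: "r > 0" for u r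
  proof -
    obtain G where "finite G" "G \<subseteq> D" "fine_net X (\<lambda>p. \<gamma> p \<bullet> u) G r"
      by (rule finite_fine_net_exists[OF X(1,2) f r D(2,3)])
    then show ?thesis using fine_net_mono D(2) by blast
  qed
  show "{\<theta> \<in> space borel. a < ?pw \<theta>} \<in> sets borel"
  proof (cases "a < 0")
    case True
    then have "{\<theta> \<in> space borel. a < ?pw \<theta>} = UNIV"
      using piece_width_bounds(1)[OF X(1,2) f] by (auto intro: less_le_trans)
    then show ?thesis by simp
  next
    case False
    have "a < ?pw \<theta> \<longleftrightarrow> 0 < snd (snd \<theta>) \<and>
        (\<exists>T\<in>\<T>. wide_witness X (\<lambda>p. \<gamma> p \<bullet> fst (snd \<theta>)) (fst \<theta>) (snd (snd \<theta>)) T a)" for \<theta>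
    proof (cases "0 < snd (snd \<theta>)")
      case True
      have "a < ?pw \<theta> \<longleftrightarrow> many_wide X (\<lambda>p. \<gamma> p \<bullet> fst (snd \<theta>)) (fst \<theta>) (snd (snd \<theta>)) (Suc k) a"
        using False by (intro piece_width_gt_iff X f True) simp
      also have "\<dots> \<longleftrightarrow> (\<exists>T \<subseteq> D \<times> D \<times> UNIV. finite T \<and> card T = Suc k \<and>
          wide_witness X (\<lambda>p. \<gamma> p \<bullet> fst (snd \<theta>)) (fst \<theta>) (snd (snd \<theta>)) T a)"
        using False by (intro many_wide_iff_witness X f True D net) simp_all
      finally show ?thesis using True by (simp add: \<T>_def)
    next
      case F: False
      then show ?thesis using False by (simp add: piece_width_nonpos)
    qed
    then have "{\<theta> \<in> space borel. a < ?pw \<theta>} = {\<theta>. 0 < snd (snd \<theta>)} \<inter>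
        (\<Union>T\<in>\<T>. {\<theta>. wide_witness X (\<lambda>p. \<gamma> p \<bullet> fst (snd \<theta>)) (fst \<theta>) (snd (snd \<theta>)) T a})"
      by auto
    also have "\<dots> \<in> sets borel"
    proof (rule sets.Int, goal_cases)
      case 1
      have "open {\<theta> :: real \<times> (real ^ 'n) \<times> real. 0 < snd (snd \<theta>)}"
        by (intro open_Collect_less continuous_intros)
      then show ?case by simp
    next
      case 2
      have "{\<theta>. wide_witness X (\<lambda>p. \<gamma> p \<bullet> fst (snd \<theta>)) (fst \<theta>) (snd (snd \<theta>)) T a} \<in> sets borel" if "T \<in> \<T>" for T
        using pred_wide_witness[OF X(1,3), of T a] that by (simp add: \<T>_def pred_def)
      then show ?case by (intro sets.countable_UN' c\<T>) auto
    qed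
    finally show ?thesis .
  qed
qed

lemma borel_measurable_slab_length:
  fixes X :: "'a::metric_space set" and \<gamma> :: "'a \<Rightarrow> real ^ 'n"
  assumes X: "compact X" "locally connected X" "continuous_on X \<gamma>"
    and D: "countable D" "D \<subseteq> X" "X \<subseteq> closure D"
  shows "(\<lambda>\<theta> :: real \<times> (real ^ 'n) \<times> real. slab_length X \<gamma> (fst \<theta>) (fst (snd \<theta>)) (snd (snd \<theta>)))
    \<in> borel_measurable borel"
  unfolding slab_length_eq
  using borel_measurable_piece_width[OF assms] by (intro borel_measurable_suminf borel_measurable_divide) auto

subsection \<open>Almost every slab decomposition is stable\<close>

text \<open>For fixed \<open>d\<close>, \<open>e\<close> and midline \<open>m\<close>, the
  thicknesses at which the points are joined form an upward closed set, so at most one of them is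
  minimal. Fubini's theorem turns this null set of \<open>h\<close> for every \<open>m\<close> into
  a null set of \<open>m\<close> for almost every \<open>h\<close>, and only countably many triples
  \<open>(d, e, j)\<close> have to be combined.\<close>

lemma AE_stable_slabs:
  fixes X :: "'a::metric_space set" and f :: "'a \<Rightarrow> real"
  assumes X: "compact X" "continuous_on X f" and D: "countable D"
  shows "AE \<mu> in lborel. AE x in lborel. 0 < \<mu> \<longrightarrow> stable_slabs X f D x \<mu>"
proof -
  define J where "J d e m h \<longleftrightarrow> connected_component (level X f (m - h / 2) (m + h / 2)) d e" for d e m h
  \<comment> \<open>This says that \<open>h\<close> is the least thickness joining the points. By
    monotonicity the sequence \<open>2 / Suc n\<close> tests all smaller thicknesses, which keeps
    the condition Borel.\<close>
  define bad where "bad d e m h \<longleftrightarrow> J d e m h \<and> (\<forall>n. \<not> J d e m (h - 2 / Suc n))" for d e m h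
  have J_mono: "J d e m h'" if "J d e m h" "h \<le> h'" for d e m h h'
    using that unfolding J_def by (elim connected_component_of_subset) (auto simp: level_def)
  have unique: "h = h'" if "bad d e m h" "bad d e m h'" for d e m h h'
  proof -
    have "\<not> h < h'" if b: "bad d e m h" "bad d e m h'" for h h'
    proof
      assume "h < h'"
      then have "0 < (h' - h) / 2" by simp
      then obtain n where n: "1 / real (Suc n) < (h' - h) / 2"
        by (rule nat_approx_posE)
      define q where "q = 1 / real (Suc n)"
      have q: "2 / real (Suc n) = 2 * q" by (simp add: q_def)
      have "q < (h' - h) / 2" using n unfolding q_def .
      then have "h \<le> h' - 2 * q" by (simp add: field_simps)
      then have "h \<le> h' - 2 / real (Suc n)" unfolding q .
      then have "J d e m (h' - 2 / real (Suc n))"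
        using J_mono[of d e m h] b(1) by (simp add: bad_def)
      then show False using b(2) by (simp add: bad_def)
    qed
    from this[OF that] this[OF that(2,1)] show ?thesis by simp
  qed
  have pJ: "Measurable.pred borel (\<lambda>\<theta>. J d e (fst \<theta>) (snd \<theta> - c))" for d e c
  proof -
    have "closed {\<theta> :: real \<times> real. J d e (fst \<theta>) (snd \<theta> - c)}"
      unfolding J_def
      by (intro closed_connected_component_level X continuous_intros uniform_limit_const) auto
    then show ?thesis by (simp add: pred_def borel_closed)
  qed
  have pbad: "Measurable.pred borel (\<lambda>\<theta>. bad d e (fst \<theta>) (snd \<theta>))" for d e
    unfolding bad_def using pJ[of d e 0] pJ[of d e] by (intro pred_intros_logic pred_intros_countable) auto
  have AEbad: "AE h in lborel. AE m in lborel. \<not> bad d e m h" for d e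
  proof (subst lborel_pair.AE_commute[symmetric])
    have s: "sets (lborel \<Otimes>\<^sub>M lborel) = sets (borel :: (real \<times> real) measure)"
      by (simp only: lborel_prod sets_lborel)
    have "{\<theta>. \<not> bad d e (fst \<theta>) (snd \<theta>)} \<in> sets borel"
      using pred_intros_logic(2)[OF pbad[of d e]] by (simp add: pred_def)
    then show "{\<theta> \<in> space (lborel \<Otimes>\<^sub>M lborel). \<not> bad d e (fst \<theta>) (snd \<theta>)} \<in> sets (lborel \<Otimes>\<^sub>M lborel)"
      unfolding s by (simp add: space_pair_measure)
    have "AE h in lborel. \<not> bad d e m h" for m
    proof (cases "\<exists>h. bad d e m h")
      case True
      then obtain h0 where "bad d e m h0" ..
      then show ?thesis
        by (intro eventually_mono[OF AE_lborel_singleton[of h0]]) (use unique in blast)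
    qed simp
    then show "AE m in lborel. AE h in lborel. \<not> bad d e m h" by simp
  qed
  \<comment> \<open>For fixed \<open>\<mu> > 0\<close> the midline of slab \<open>j\<close> is
    affine in \<open>x\<close> with slope \<open>\<mu>\<close>, so null sets of midlines pull back
    to null sets of \<open>x\<close>.\<close>
  have "AE \<mu> in lborel. AE x in lborel. 0 < \<mu> \<longrightarrow> \<not> bad d e (\<mu> * (of_int j + 1 / 2) + \<mu> * x) \<mu>" for d e and j :: int
    using AEbad[of d e]
  proof eventually_elim
    case (elim \<mu>)
    show ?case
    proof (cases "0 < \<mu>")
      case True
      have "(\<lambda>m. (m, \<mu>)) \<in> borel_measurable (borel :: real measure)"
        by (intro borel_measurable_continuous_onI continuous_intros)
      from measurable_compose[OF this pbad[of d e]]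
      have "Measurable.pred borel (\<lambda>m. \<not> bad d e m \<mu>)" by simp
      with AE_borel_affine[of \<mu> _ "\<mu> * (of_int j + 1 / 2)"] True elim show ?thesis by simp
    qed simp
  qed
  then have "AE \<mu> in lborel. \<forall>(d, e, j)\<in>D \<times> D \<times> (UNIV :: int set). AE x in lborel.
      0 < \<mu> \<longrightarrow> \<not> bad d e (\<mu> * (of_int j + 1 / 2) + \<mu> * x) \<mu>"
    using D by (subst AE_ball_countable) auto
  then show ?thesis
  proof eventually_elim
    case (elim \<mu>)
    have "AE x in lborel. \<forall>(d, e, j)\<in>D \<times> D \<times> (UNIV :: int set).
        0 < \<mu> \<longrightarrow> \<not> bad d e (\<mu> * (of_int j + 1 / 2) + \<mu> * x) \<mu>"
      using D elim by (subst AE_ball_countable) auto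
    then show ?case
    proof eventually_elim
      case (elim x)
      show ?case
        unfolding stable_slabs_def
      proof (intro impI ballI allI)
        fix d e j assume mu: "0 < \<mu>" and de: "d \<in> D" "e \<in> D"
          and c: "connected_component (in_slab X f x \<mu> j) d e"
        define m where "m = \<mu> * (of_int j + 1 / 2) + \<mu> * x"
        have m: "m - h / 2 = \<mu> * (of_int j + x) + (\<mu> - h) / 2" "m + h / 2 = \<mu> * (of_int j + 1 + x) - (\<mu> - h) / 2" for h
          by (auto simp: m_def field_simps)
        have "J d e m \<mu>" using c unfolding J_def m in_slab_def by simp
        moreover have "\<not> bad d e m \<mu>" using elim mu de unfolding m_def by blast
        ultimately obtain n where "J d e m (\<mu> - 2 / Suc n)" by (auto simp: bad_def)
        then show "\<exists>\<delta>>0. connected_component (level X f (\<mu> * (of_int j + x) + \<delta>) (\<mu> * (of_int j + 1 + x) - \<delta>)) d e"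
          unfolding J_def m by (intro exI[of _ "(\<mu> - (\<mu> - 2 / real (Suc n))) / 2"] conjI) simp_all
      qed
    qed
  qed
qed

subsection \<open>Continuity of the length\<close>

lemma compact_countable_dense_subset:
  fixes X :: "'a::metric_space set"
  assumes "compact X"
  obtains D where "countable D" "D \<subseteq> X" "X \<subseteq> closure D"
proof -
  have "\<forall>n. \<exists>K. finite K \<and> K \<subseteq> X \<and> X \<subseteq> (\<Union>x\<in>K. ball x (1 / real (Suc n)))"
    using seq_compact_imp_totally_bounded[OF compact_imp_seq_compact[OF assms]] by simp
  then obtain K where K: "\<And>n. finite (K n)" "\<And>n. K n \<subseteq> X" "\<And>n. X \<subseteq> (\<Union>x\<in>K n. ball x (1 / real (Suc n)))"
    by metis
  have "X \<subseteq> closure (\<Union>n. K n)"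
  proof
    fix z assume z: "z \<in> X"
    show "z \<in> closure (\<Union>n. K n)"
      unfolding closure_approachable
    proof (intro allI impI)
      fix e :: real assume "e > 0"
      then obtain n where n: "1 / real (Suc n) < e" using nat_approx_posE by blast
      obtain y where "y \<in> K n" "dist y z < 1 / real (Suc n)" using K(3)[of n] z by auto
      then show "\<exists>y\<in>\<Union>n. K n. dist y z < e" using n by (meson UN_I UNIV_I less_trans)
    qed
  qed
  moreover have "countable (\<Union>n. K n)" using K(1) by (intro countable_UN) (auto intro: countable_finite)
  ultimately show ?thesis using that[of "\<Union>n. K n"] K(2) by blast
qed

lemma finite_measure_integral_abs_le:
  fixes f :: "'b \<Rightarrow> real"
  assumes M: "finite_measure M" and f: "f \<in> borel_measurable M" "\<And>x. x \<in> space M \<Longrightarrow> \<bar>f x\<bar> \<le> B"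
  shows "\<bar>\<integral>x. f x \<partial>M\<bar> \<le> B * measure M (space M)"
proof -
  interpret finite_measure M by fact
  have i: "integrable M f" using f by (intro integrable_const_bound[of _ B]) auto
  have "\<bar>\<integral>x. f x \<partial>M\<bar> \<le> (\<integral>x. \<bar>f x\<bar> \<partial>M)" using integral_norm_bound[of M f] by simp
  also have "\<dots> \<le> (\<integral>x. B \<partial>M)" using i f(2) by (intro integral_mono) auto
  finally show ?thesis by (simp add: mult.commute)
qed

lemma finite_measure_sphere_measure: "finite_measure (sphere_measure :: (real ^ 'n) measure)"
  by (rule finite_measureI) (simp only: emeasure_sphere_measure_space, simp)

text \<open>Stability holds for almost every \<open>(x, \<mu>)\<close> with \<open>u\<close> fixed,
  so the integral over \<open>u\<close> is moved outermost; dominated convergence is then used for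
  \<open>x\<close>, \<open>\<mu>\<close> and \<open>u\<close> in turn.\<close>

lemma len_tendsto:
  fixes X :: "'a::metric_space set" and \<gamma> :: "'a \<Rightarrow> real ^ 'n"
  assumes X: "compact X" "locally connected X" and \<gamma>: "continuous_on X \<gamma>" "\<And>n. continuous_on X (\<gamma>' n)"
    and lim: "uniform_limit X \<gamma>' \<gamma> sequentially"
  shows "(\<lambda>n. len X (\<gamma>' n)) \<longlonglongrightarrow> len X \<gamma>"
proof -
  obtain D where D: "countable D" "D \<subseteq> X" "X \<subseteq> closure D"
    using compact_countable_dense_subset[OF X(1)] .
  \<comment> \<open>The restricted measures are finite, so constants are integrable bounds for all
    integrands below.\<close>
  define M1 where "M1 = restrict_space (lborel :: real measure) {0<..1}"
  define M3 where "M3 = restrict_space (lborel :: real measure) {0..1}"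
  let ?S = "sphere_measure :: (real ^ 'n) measure"
  have sp: "space M1 = {0<..1}" "space M3 = {0..1}" by (auto simp: M1_def M3_def space_restrict_space)
  have fin: "finite_measure M1" "finite_measure M3" "finite_measure ?S"
    unfolding M1_def M3_def
    by (auto intro!: finite_measureI finite_measure_sphere_measure simp: emeasure_restrict_space space_restrict_space)
  interpret F1: finite_measure M1 by fact
  interpret F3: finite_measure M3 by fact
  interpret FS: finite_measure ?S by fact
  interpret P: pair_sigma_finite M1 ?S ..
  have id1: "(\<lambda>x. x) \<in> borel_measurable M1" and id3: "(\<lambda>x. x) \<in> borel_measurable M3"
    unfolding M1_def M3_def by (auto intro!: measurable_restrict_space1)
  have idS: "(\<lambda>x. x) \<in> borel_measurable ?S"
    unfolding measurable_cong_sets[OF sets_sphere_measure refl] by (auto intro!: measurable_restrict_space1)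
  define H where "H g u \<mu> = (\<integral>x. slab_length X g x u \<mu> \<partial>M3)" for g :: "'a \<Rightarrow> real ^ 'n" and u \<mu>
  define G where "G g u = (\<integral>\<mu>. H g u \<mu> \<partial>M1)" for g :: "'a \<Rightarrow> real ^ 'n" and u
  have L: "(\<lambda>x. slab_length X g x u \<mu>) \<in> borel_measurable M3" if g: "continuous_on X g" for g :: "'a \<Rightarrow> real ^ 'n" and u \<mu>
  proof -
    have "(\<lambda>x. (x, u, \<mu>)) \<in> borel_measurable (borel :: real measure)"
      by (intro borel_measurable_continuous_onI continuous_intros)
    from measurable_compose[OF measurable_compose[OF id3 this] borel_measurable_slab_length[OF X g D]]
    show ?thesis by simp
  qed
  have Lb: "\<bar>slab_length X g x u \<mu>\<bar> \<le> 2" if "continuous_on X g" "\<mu> \<in> space M1" for g :: "'a \<Rightarrow> real ^ 'n" and x u \<mu>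
    using slab_length_bounds[OF X that(1), of x u \<mu>] that(2) by (auto simp: sp)
  define c where "c = 2 * measure M3 (space M3)"
  have Hb: "\<bar>H g u \<mu>\<bar> \<le> c" if "continuous_on X g" "\<mu> \<in> space M1" for g :: "'a \<Rightarrow> real ^ 'n" and u \<mu>
    unfolding H_def c_def using L[OF that(1)] Lb[OF that] by (intro finite_measure_integral_abs_le fin) auto
  have Hm: "(\<lambda>p. H g (snd p) (fst p)) \<in> borel_measurable (M1 \<Otimes>\<^sub>M ?S)" if g: "continuous_on X g" for g :: "'a \<Rightarrow> real ^ 'n"
    unfolding H_def
  proof (rule F3.borel_measurable_lebesgue_integral)
    have "(\<lambda>q. (snd q, snd (fst q), fst (fst q))) \<in> borel_measurable ((M1 \<Otimes>\<^sub>M ?S) \<Otimes>\<^sub>M M3)"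
      unfolding borel_prod[symmetric]
      by (intro measurable_Pair measurable_compose[OF measurable_snd id3]
          measurable_compose[OF measurable_compose[OF measurable_fst measurable_snd] idS]
          measurable_compose[OF measurable_compose[OF measurable_fst measurable_fst] id1])
    from measurable_compose[OF this borel_measurable_slab_length[OF X g D]]
    show "(\<lambda>(p, x). slab_length X g x (snd p) (fst p)) \<in> borel_measurable ((M1 \<Otimes>\<^sub>M ?S) \<Otimes>\<^sub>M M3)"
      by (simp add: split_beta)
  qed
  have Hm1: "H g u \<in> borel_measurable M1" if "continuous_on X g" "u \<in> space ?S" for g :: "'a \<Rightarrow> real ^ 'n" and u
    using measurable_compose[OF measurable_Pair2'[OF that(2)] Hm[OF that(1)]] by simp
  have Gm: "G g \<in> borel_measurable ?S" if g: "continuous_on X g" for g :: "'a \<Rightarrow> real ^ 'n"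
    unfolding G_def
  proof (rule F1.borel_measurable_lebesgue_integral)
    show "(\<lambda>(u, \<mu>). H g u \<mu>) \<in> borel_measurable (?S \<Otimes>\<^sub>M M1)"
      using measurable_compose[OF measurable_pair_swap' Hm[OF g]] by (simp add: split_beta)
  qed
  have Gb: "\<bar>G g u\<bar> \<le> c * measure M1 (space M1)" if "continuous_on X g" "u \<in> space ?S" for g :: "'a \<Rightarrow> real ^ 'n" and u
    unfolding G_def using Hm1[OF that] Hb[OF that(1)] by (intro finite_measure_integral_abs_le fin) auto
  \<comment> \<open>The order of integration over \<open>u\<close> and \<open>\<mu>\<close> is
    exchanged here, by the joint measurability \<open>Hm\<close> and the bound
    \<open>Hb\<close>.\<close>
  have len_G: "len X g = (\<integral>u. G g u \<partial>?S)" if g: "continuous_on X g" for g :: "'a \<Rightarrow> real ^ 'n"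
  proof -
    have "len X g = (\<integral>\<mu>. \<integral>u. H g u \<mu> \<partial>?S \<partial>M1)"
      unfolding len_def H_def M1_def M3_def set_lebesgue_integral_def by (simp add: integral_restrict_space)
    also have "\<dots> = (\<integral>u. G g u \<partial>?S)"
      unfolding G_def
    proof (rule P.Fubini_integral[symmetric])
      interpret PF: finite_measure "M1 \<Otimes>\<^sub>M ?S"
        by (intro finite_measure_pair_measure fin)
      show "integrable (M1 \<Otimes>\<^sub>M ?S) (\<lambda>(\<mu>, u). H g u \<mu>)"
        using Hm[OF g] Hb[OF g] by (intro PF.integrable_const_bound[of _ c] AE_I2) (auto simp: split_beta space_pair_measure)
    qed
    finally show ?thesis .
  qed
  have G_lim: "(\<lambda>n. G (\<gamma>' n) u) \<longlonglongrightarrow> G \<gamma> u" if u: "u \<in> space ?S" for u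
    unfolding G_def
  proof (rule integral_dominated_convergence[where w="\<lambda>_. c"])
    have f: "continuous_on X (\<lambda>p. \<gamma> p \<bullet> u)" using \<gamma>(1) by (intro continuous_intros)
    have "AE \<mu> in M1. AE x in lborel. 0 < \<mu> \<longrightarrow> stable_slabs X (\<lambda>p. \<gamma> p \<bullet> u) D x \<mu>"
      unfolding M1_def using AE_stable_slabs[OF X(1) f D(1)]
      by (subst AE_restrict_space_iff) (auto elim: eventually_mono)
    moreover have "AE \<mu> in M1. \<mu> \<in> space M1" by simp
    ultimately show "AE \<mu> in M1. (\<lambda>n. H (\<gamma>' n) u \<mu>) \<longlonglongrightarrow> H \<gamma> u \<mu>"
    proof eventually_elim
      case (elim \<mu>)
      then have mu: "0 < \<mu>" by (simp add: sp)
      show ?case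
        unfolding H_def
      proof (rule integral_dominated_convergence[where w="\<lambda>_. 2"])
        have "AE x in M3. stable_slabs X (\<lambda>p. \<gamma> p \<bullet> u) D x \<mu>"
          unfolding M3_def using elim(1) mu by (subst AE_restrict_space_iff) (auto elim: eventually_mono)
        then show "AE x in M3. (\<lambda>n. slab_length X (\<gamma>' n) x u \<mu>) \<longlonglongrightarrow> slab_length X \<gamma> x u \<mu>"
          by (rule eventually_mono) (rule slab_length_tendsto[OF X \<gamma> mu D(2,3) _ lim])
      qed (use L \<gamma> Lb elim(2) in \<open>auto\<close>)
    qed
  qed (use Hm1 Hb \<gamma> u in \<open>auto\<close>)
  have "(\<lambda>n. \<integral>u. G (\<gamma>' n) u \<partial>?S) \<longlonglongrightarrow> (\<integral>u. G \<gamma> u \<partial>?S)"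
    by (rule integral_dominated_convergence[where w="\<lambda>_. c * measure M1 (space M1)"])
      (use Gm Gb G_lim \<gamma> in \<open>auto\<close>)
  then show ?thesis using len_G \<gamma> by simp
qed

theorem proposition7:
  fixes X :: "'a::metric_space set"
  assumes "CARD('n) \<ge> 2"
    and "X \<noteq> {}" "compact X" "connected X" "locally connected X"
  shows "continuous_map
    (mtopology_of (cfunspace (top_of_set X) (euclidean_metric :: (real ^ 'n) metric)))
    euclideanreal (len X)"
proof -
  let ?C = "cfunspace (top_of_set X) (euclidean_metric :: (real ^ 'n) metric)"
  have mem: "continuous_on X g" if "g \<in> mspace ?C" for g
    using that mspace_cfunspace_compact[OF assms(3)] by blast
  have norm_le: "norm (g p - h p) \<le> mdist ?C g h" if gh: "g \<in> mspace ?C" "h \<in> mspace ?C" and p: "p \<in> X" for g h p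
  proof -
    have "compact ((\<lambda>p. norm (g p - h p)) ` X)"
      using mem gh assms(3) by (intro compact_continuous_image continuous_intros) auto
    then have "bdd_above ((\<lambda>p. norm (g p - h p)) ` X)"
      by (intro bounded_imp_bdd_above compact_imp_bounded)
    then show ?thesis
      unfolding mdist_cfunspace_compact[OF assms(3,2) gh] using p by (intro cSUP_upper)
  qed
  have "\<exists>\<delta>>0. \<forall>h. h \<in> mspace ?C \<and> mdist ?C g h < \<delta> \<longrightarrow> dist (len X g) (len X h) < \<epsilon>"
    if g: "g \<in> mspace ?C" and \<epsilon>: "\<epsilon> > 0" for g \<epsilon>
  proof (rule ccontr)
    assume "\<not> ?thesis"
    \<comment> \<open>A failure at \<open>\<epsilon>\<close> yields maps \<open>h n\<close> at
      distance less than \<open>1 / Suc n\<close> from \<open>g\<close>. They converge uniformly to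
      \<open>g\<close>, which contradicts \<open>len_tendsto\<close>.\<close>
    then have "\<forall>n. \<exists>h. h \<in> mspace ?C \<and> mdist ?C g h < 1 / Suc n \<and> \<not> dist (len X g) (len X h) < \<epsilon>"
      by (metis of_nat_0_less_iff zero_less_Suc zero_less_divide_1_iff)
    then obtain h where h: "\<And>n. h n \<in> mspace ?C" "\<And>n. mdist ?C g (h n) < 1 / Suc n"
      "\<And>n. \<not> dist (len X g) (len X (h n)) < \<epsilon>"
      by metis
    have "uniform_limit X h g sequentially"
    proof (rule uniform_limitI)
      fix e :: real assume "e > 0"
      then obtain N where N: "1 / real (Suc N) < e" using nat_approx_posE by blast
      have "dist (h n p) (g p) < e" if "n \<ge> N" "p \<in> X" for n p
      proof -
        have "dist (h n p) (g p) \<le> mdist ?C g (h n)"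
          using norm_le[OF g h(1) that(2)] by (simp add: dist_norm norm_minus_commute)
        also have "\<dots> < 1 / Suc n" by (rule h(2))
        also have "\<dots> \<le> 1 / Suc N" using that(1) by (simp add: field_simps)
        finally show ?thesis using N by simp
      qed
      then show "\<forall>\<^sub>F n in sequentially. \<forall>p\<in>X. dist (h n p) (g p) < e"
        by (auto simp: eventually_sequentially)
    qed
    from len_tendsto[OF assms(3,5) mem[OF g] mem[OF h(1)] this]
    have "\<forall>\<^sub>F n in sequentially. dist (len X (h n)) (len X g) < \<epsilon>" using \<epsilon> by (rule tendstoD)
    then show False using h(3) by (auto simp: eventually_sequentially dist_commute)
  qed
  then show ?thesis
    unfolding mtopology_of_def mtopology_is_euclidean[symmetric]
    by (subst Metric_space.metric_continuous_map[OF Metric_space_mspace_mdist Met_TC.Metric_space_axioms]) auto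
qed

end
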